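(* In the two-group random mixture model with $\theta_i$ iid $\mathrm{Bern}(\pi_1)$, $\pi_0=1-\pi_1\in(0,1)$, $X_i\sim N(0,1)$ given $\theta_i=0$ and $X_i\sim N(\mu,1)$ given $\theta_i=1$ (conditionally independent), where $\mu>0$: (a) There exists $\mu_0>0$ such that for any $\mu\in(0,\mu_0)$, $\mathsf{mFNR}^*(\alpha)>\pi_1\big(1-\frac{\alpha}{\pi_0}\big)$ for any $\alpha\in(0,\pi_0)$ and any $\pi_0\in(0,1)$. (b) For any $\mu>0$ and $\pi_0\in(0,1)$, there exists $\alpha_0=\alpha_0(\mu,\pi_0)\in(0,\pi_0)$ such that $\mathsf{mFNR}^*(\alpha)>\pi_1\big(1-\frac{\alpha}{\pi_0}\big)$ for any $\alpha\in(0,\alpha_0)$. (c) For any $\mu>0$ and $\pi_0\in(0,1)$, there exists $\alpha_1=\alpha_1(\mu,\pi_0)\in(0,\pi_0)$ such that $\mathsf{mEFN}^*(\alpha)>\pi_1\big(1-\frac{\alpha}{\pi_0}\big)$ for any $\alpha\in(0,\alpha_1)$. (d) For any $\mu>0$ and $\pi_0\in(0,1)$, there exists $\alpha_2=\alpha_2(\mu,\pi_0)\in(0,\pi_0)$ such that $\mathsf{mEFN}^*(\alpha)<\pi_1\big(1-\frac{\alpha}{\pi_0}\big)$ for any $\alpha\in(\alpha_2,\pi_0)$.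
   Context: A (possibly randomized) decision rule $\delta^n\in\{0,1\}^n$ is given by a Markov kernel applied to $X^n$ (conditionally independent of $\theta^n$ given $X^n$). With $0/0=0$: $\mathrm{mFDR}(\delta^n)=\frac{\mathbb E[\sum_i\delta_i(1-\theta_i)]}{\mathbb E[\sum_i\delta_i]}$, $\mathrm{mFNR}(\delta^n)=\frac{\mathbb E[\sum_i(1-\delta_i)\theta_i]}{\mathbb E[\sum_i(1-\delta_i)]}$, $\mathrm{EFN}(\delta^n)=\frac1n\mathbb E[\sum_i\theta_i(1-\delta_i)]$. $\mathsf{mFNR}^*(\alpha)=\inf\{\mathrm{mFNR}(\delta^n):\mathrm{mFDR}(\delta^n)\le\alpha\}$ and $\mathsf{mEFN}^*(\alpha)=\inf\{\mathrm{EFN}(\delta^n):\mathrm{mFDR}(\delta^n)\le\alpha\}$, infima over all decision rules; these values do not depend on $n$. In this Gaussian model, for $\alpha\in(0,\pi_0)$, the curves $(\alpha,\mathsf{mFNR}^*(\alpha))$ and $(\alpha,\mathsf{mEFN}^*(\alpha))$ are parametrized by $z\in\mathbb R$ via $\alpha=\frac{\pi_0(1-\Phi(z))}{1-(\pi_0\Phi(z)+\pi_1\Phi(z-\mu))}$, $\mathsf{mFNR}^*=\frac{\pi_1\Phi(z-\mu)}{\pi_0\Phi(z)+\pi_1\Phi(z-\mu)}$ and $\mathsf{mEFN}^*=\pi_1\Phi(z-\mu)$, where $\Phi$ is the standard normal CDF. *)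

theory Defs
  imports "HOL-Probability.Probability"
begin

text \<open>\<open>p0\<close> is the probability of a null, \<open>\<theta> i = False\<close>; the value \<open>False\<close> outside \<open>{..<n}\<close> is
  padding.\<close>

definition theta_law :: "nat \<Rightarrow> real \<Rightarrow> (nat \<Rightarrow> bool) measure" where
  "theta_law n p0 = measure_pmf (Pi_pmf {..<n} False (\<lambda>_. bernoulli_pmf (1 - p0)))"

abbreviation obs_space :: "nat \<Rightarrow> (nat \<Rightarrow> real) measure" where
  "obs_space n \<equiv> PiM {..<n} (\<lambda>_. borel)"

abbreviation dec_space :: "nat \<Rightarrow> (nat \<Rightarrow> bool) measure" where
  "dec_space n \<equiv> PiM {..<n} (\<lambda>_. count_space UNIV)"

definition obs_law :: "nat \<Rightarrow> real \<Rightarrow> (nat \<Rightarrow> bool) \<Rightarrow> (nat \<Rightarrow> real) measure" where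
  "obs_law n \<mu> \<theta> =
     PiM {..<n} (\<lambda>i. density lborel (normal_density (if \<theta> i then \<mu> else 0) 1))"

definition decision_rules :: "nat \<Rightarrow> ((nat \<Rightarrow> real) \<Rightarrow> (nat \<Rightarrow> bool) measure) set" where
  "decision_rules n = measurable (obs_space n) (prob_algebra (dec_space n))"

text \<open>Joint law of \<open>(\<theta>, X, \<delta>)\<close>. The kernel sees only \<open>X\<close>, so the decision is conditionally
  independent of \<open>\<theta>\<close> given \<open>X\<close>.\<close>

definition joint_law ::
  "nat \<Rightarrow> real \<Rightarrow> real \<Rightarrow> ((nat \<Rightarrow> real) \<Rightarrow> (nat \<Rightarrow> bool) measure) \<Rightarrow>
     ((nat \<Rightarrow> bool) \<times> (nat \<Rightarrow> real) \<times> (nat \<Rightarrow> bool)) measure" where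
  "joint_law n \<mu> p0 K =
     theta_law n p0 \<bind> (\<lambda>\<theta>. obs_law n \<mu> \<theta> \<bind> (\<lambda>x. K x \<bind> (\<lambda>d.
       return (count_space UNIV \<Otimes>\<^sub>M obs_space n \<Otimes>\<^sub>M dec_space n) (\<theta>, x, d))))"

lemma obs_law_prob_algebra: "obs_law n m t \<in> space (prob_algebra (obs_space n))"
proof -
  have p: "prob_space (density lborel (normal_density (if t i then m else 0) 1))" for i
    by (simp add: prob_space_normal_density)
  have "prob_space (obs_law n m t)"
    unfolding obs_law_def by (intro prob_space_PiM p)
  moreover have "sets (obs_law n m t) = sets (obs_space n)"
    unfolding obs_law_def by (intro sets_PiM_cong) auto
  ultimately show ?thesis by (simp add: space_prob_algebra)
qed

lemma joint_law_prob_algebra: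
  assumes K: "K \<in> decision_rules n"
  shows "joint_law n m p0 K \<in>
    space (prob_algebra (count_space UNIV \<Otimes>\<^sub>M obs_space n \<Otimes>\<^sub>M dec_space n))"
proof -
  let ?J = "count_space UNIV \<Otimes>\<^sub>M obs_space n \<Otimes>\<^sub>M dec_space n :: ((nat \<Rightarrow> bool) \<times> (nat \<Rightarrow> real) \<times> (nat \<Rightarrow> bool)) measure"
  note [measurable] = K[unfolded decision_rules_def]
  have 1: "(\<lambda>x. K x \<bind> (\<lambda>d. return ?J (t, x, d))) \<in> obs_space n \<rightarrow>\<^sub>M prob_algebra ?J" for t
    by measurable
  have 2: "obs_law n m t \<bind> (\<lambda>x. K x \<bind> (\<lambda>d. return ?J (t, x, d))) \<in> space (prob_algebra ?J)" for t
    using prob_space_bind'[OF obs_law_prob_algebra 1] sets_bind'[OF obs_law_prob_algebra 1] by (simp add: space_prob_algebra)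
  have 3: "theta_law n p0 \<in> space (prob_algebra (count_space UNIV))"
    unfolding theta_law_def by (simp add: space_prob_algebra measure_pmf.prob_space_axioms)
  have 4: "(\<lambda>t. obs_law n m t \<bind> (\<lambda>x. K x \<bind> (\<lambda>d. return ?J (t, x, d)))) \<in> count_space UNIV \<rightarrow>\<^sub>M prob_algebra ?J"
    using 2 by auto
  show ?thesis unfolding joint_law_def
    using prob_space_bind'[OF 3 4] sets_bind'[OF 3 4] by (simp add: space_prob_algebra)
qed

definition joint_expectation ::
  "nat \<Rightarrow> real \<Rightarrow> real \<Rightarrow> ((nat \<Rightarrow> real) \<Rightarrow> (nat \<Rightarrow> bool) measure) \<Rightarrow>
     ((nat \<Rightarrow> bool) \<Rightarrow> (nat \<Rightarrow> bool) \<Rightarrow> real) \<Rightarrow> real" where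
  "joint_expectation n \<mu> p0 K f = (LINT (\<theta>, x, d)|joint_law n \<mu> p0 K. f \<theta> d)"

text \<open>The convention \<open>0 / 0 = 0\<close> is HOL's division by zero.\<close>

definition mFDR :: "nat \<Rightarrow> real \<Rightarrow> real \<Rightarrow> ((nat \<Rightarrow> real) \<Rightarrow> (nat \<Rightarrow> bool) measure) \<Rightarrow> real" where
  "mFDR n \<mu> p0 K =
     joint_expectation n \<mu> p0 K (\<lambda>\<theta> d. \<Sum>i<n. of_bool (d i) * (1 - of_bool (\<theta> i))) /
     joint_expectation n \<mu> p0 K (\<lambda>\<theta> d. \<Sum>i<n. of_bool (d i))"

definition mFNR :: "nat \<Rightarrow> real \<Rightarrow> real \<Rightarrow> ((nat \<Rightarrow> real) \<Rightarrow> (nat \<Rightarrow> bool) measure) \<Rightarrow> real" where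
  "mFNR n \<mu> p0 K =
     joint_expectation n \<mu> p0 K (\<lambda>\<theta> d. \<Sum>i<n. (1 - of_bool (d i)) * of_bool (\<theta> i)) /
     joint_expectation n \<mu> p0 K (\<lambda>\<theta> d. \<Sum>i<n. 1 - of_bool (d i))"

definition EFN :: "nat \<Rightarrow> real \<Rightarrow> real \<Rightarrow> ((nat \<Rightarrow> real) \<Rightarrow> (nat \<Rightarrow> bool) measure) \<Rightarrow> real" where
  "EFN n \<mu> p0 K =
     1 / real n * joint_expectation n \<mu> p0 K (\<lambda>\<theta> d. \<Sum>i<n. of_bool (\<theta> i) * (1 - of_bool (d i)))"

definition mFNR_star :: "nat \<Rightarrow> real \<Rightarrow> real \<Rightarrow> real \<Rightarrow> real" where
  "mFNR_star n \<mu> p0 \<alpha> = (INF K \<in> {K \<in> decision_rules n. mFDR n \<mu> p0 K \<le> \<alpha>}. mFNR n \<mu> p0 K)"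

definition mEFN_star :: "nat \<Rightarrow> real \<Rightarrow> real \<Rightarrow> real \<Rightarrow> real" where
  "mEFN_star n \<mu> p0 \<alpha> = (INF K \<in> {K \<in> decision_rules n. mFDR n \<mu> p0 K \<le> \<alpha>}. EFN n \<mu> p0 K)"

end

theory Submission
  imports Defs
begin

text \<open>Averaging the conditional probability of selecting coordinate \<open>i\<close> given \<open>X\<^sub>i = y\<close> over all
  other randomness and over \<open>i\<close> turns any decision rule into one test function \<open>\<psi>\<close> on the real line.
  All error rates depend only on its size \<open>A = \<integral>\<psi> dN(0,1)\<close> and power \<open>B = \<integral>\<psi> dN(\<mu>,1)\<close>.

  For (c), the third moment of the likelihood ratio gives \<open>B \<le> c A + exp (3 \<mu>\<^sup>2) / c\<^sup>2\<close> for all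
  \<open>c > 0\<close>; since \<open>mFDR \<le> \<alpha>\<close> forces \<open>A = O(\<alpha> B)\<close>, this yields \<open>B = O(\<alpha>\<^sup>2)\<close>, which is eventually
  below \<open>\<alpha> / \<pi>0\<close>. Part (b) follows as \<open>mFNR \<ge> EFN\<close>.

  For (a), the inequality in question reduces to \<open>A (1 - B) > \<pi>0 \<pi>1 (B - A)\<^sup>2\<close>, and the chi-square bounds
  \<open>(B - A)\<^sup>2 \<le> (exp (\<mu>\<^sup>2) - 1) min(A, 1 - B)\<close> give it for small \<open>\<mu>\<close>, uniformly in \<open>\<pi>0\<close>. Compactness of
  the set of admissible pairs \<open>(A, B)\<close> keeps the inequality strict for the infimum.

  For (d), threshold tests with threshold going to \<open>-\<infinity>\<close> attain every level close to \<open>\<pi>0\<close>, with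
  \<open>1 - B\<close> negligible compared to \<open>1 - A\<close>.\<close>

subsection \<open>Reduction to a single test function\<close>

abbreviation gauss :: "real \<Rightarrow> real measure" where
  "gauss m \<equiv> density lborel (normal_density m 1)"

lemma prob_space_gauss: "prob_space (gauss m)"
  by (simp add: prob_space_normal_density)

text \<open>The conditional probability of selecting \<open>i\<close> given \<open>X\<^sub>i = y\<close>. Given \<open>X\<^sub>i\<close>, the selection is
  independent of \<open>\<theta>\<^sub>i\<close>, so only the other coordinates are averaged out.\<close>

definition selection_prob ::
  "nat \<Rightarrow> real \<Rightarrow> real \<Rightarrow> ((nat \<Rightarrow> real) \<Rightarrow> (nat \<Rightarrow> bool) measure) \<Rightarrow> nat \<Rightarrow> real \<Rightarrow> ennreal" where
  "selection_prob n \<mu> p0 K i y =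
     (\<integral>\<^sup>+\<theta>. (\<integral>\<^sup>+x. emeasure (K (x(i := y))) {d \<in> space (dec_space n). d i}
        \<partial>PiM ({..<n} - {i}) (\<lambda>j. gauss (if \<theta> j then \<mu> else 0)))
        \<partial>measure_pmf (Pi_pmf ({..<n} - {i}) False (\<lambda>_. bernoulli_pmf (1 - p0))))"

text \<open>Finite support turns integrals over \<theta> into finite sums, so measurability in
  \<open>y\<close> and the exchange with the integral over \<open>y\<close> reduce to statements for
  each fixed \<theta>.\<close>

lemma finite_set_theta: "finite A \<Longrightarrow> finite (set_pmf (Pi_pmf A False (\<lambda>_. bernoulli_pmf p)))"
  by (rule finite_subset[OF set_Pi_pmf_subset']) (auto intro!: finite_PiE_dflt)

lemma sets_selected:
  assumes "i < n"
  shows "{d \<in> space (dec_space n). d i} \<in> sets (dec_space n)"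
proof -
  have [measurable]: "(\<lambda>d. d i) \<in> measurable (dec_space n) (count_space UNIV)"
    using assms by (intro measurable_component_singleton) simp
  show ?thesis by measurable
qed

lemma measurable_kernel_upd:
  assumes "K \<in> decision_rules n" "i < n"
  shows "(\<lambda>(x, y). emeasure (K (x(i := y))) {d \<in> space (dec_space n). d i})
    \<in> borel_measurable (PiM ({..<n} - {i}) (\<lambda>_. borel) \<Otimes>\<^sub>M borel)"
proof -
  have ins: "insert i ({..<n} - {i}) = {..<n}" using assms by auto
  have K: "K \<in> measurable (obs_space n) (subprob_algebra (dec_space n))"
    using assms by (auto simp: decision_rules_def intro: measurable_prob_algebraD)
  have S: "{d \<in> space (dec_space n). d i} \<in> sets (dec_space n)"
    using assms(2) by (rule sets_selected)
  have u: "(\<lambda>(x, y). x(i := y)) \<in> measurable (PiM ({..<n} - {i}) (\<lambda>_. borel) \<Otimes>\<^sub>M borel) (obs_space n)"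
    using measurable_add_dim[of i "{..<n} - {i}" "\<lambda>_. borel :: real measure"] unfolding ins .
  have k: "(\<lambda>x. emeasure (K x) {d \<in> space (dec_space n). d i}) \<in> borel_measurable (obs_space n)"
    by (rule measurable_compose[OF K measurable_emeasure_subprob_algebra[OF S]])
  show ?thesis using measurable_compose[OF u k] by (simp add: case_prod_beta)
qed

lemma sets_PiM_gauss: "sets (PiM A (\<lambda>j. gauss (f j))) = sets (PiM A (\<lambda>_. borel))"
  by (intro sets_PiM_cong) auto

lemma borel_measurable_nn_integral_kernel_upd:
  assumes "K \<in> decision_rules n" "i < n"
  shows "(\<lambda>y. \<integral>\<^sup>+x. emeasure (K (x(i := y))) {d \<in> space (dec_space n). d i}
    \<partial>PiM ({..<n} - {i}) (\<lambda>j. gauss (if \<theta> j then \<mu> else 0))) \<in> borel_measurable borel"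
proof -
  let ?M = "PiM ({..<n} - {i}) (\<lambda>j. gauss (if \<theta> j then \<mu> else 0))"
  interpret prob_space ?M by (intro prob_space_PiM prob_space_gauss)
  have "(\<lambda>(y, x). emeasure (K (x(i := y))) {d \<in> space (dec_space n). d i})
      \<in> borel_measurable (borel \<Otimes>\<^sub>M ?M)"
    using measurable_pair_swap[OF measurable_kernel_upd[OF assms]]
    by (simp add: measurable_cong_sets[OF sets_pair_measure_cong[OF refl sets_PiM_gauss] refl] case_prod_beta)
  then show ?thesis by (rule borel_measurable_nn_integral)
qed

lemma borel_measurable_selection_prob:
  assumes "K \<in> decision_rules n" "i < n"
  shows "selection_prob n \<mu> p0 K i \<in> borel_measurable borel"
  unfolding selection_prob_def[abs_def]
  using borel_measurable_nn_integral_kernel_upd[OF assms]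
  by (subst nn_integral_measure_pmf_finite) (auto intro!: finite_set_theta)

lemma selection_prob_le_1:
  assumes "K \<in> decision_rules n" "i < n"
  shows "selection_prob n \<mu> p0 K i y \<le> 1"
proof -
  have le: "emeasure (K (x(i := y))) {d \<in> space (dec_space n). d i} \<le> 1"
    if "x \<in> space (PiM ({..<n} - {i}) (\<lambda>j. gauss (f j)))" for x f
  proof -
    have "x(i := y) \<in> space (obs_space n)"
      using that assms(2) by (auto simp: space_PiM PiE_def Pi_def extensional_def)
    then have "K (x(i := y)) \<in> space (prob_algebra (dec_space n))"
      using assms(1) unfolding decision_rules_def by (rule measurable_space[rotated])
    then interpret prob_space "K (x(i := y))" by (simp add: space_prob_algebra)
    show ?thesis by (rule emeasure_le_1)
  qed
  have in1: "(\<integral>\<^sup>+x. emeasure (K (x(i := y))) {d \<in> space (dec_space n). d i}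
        \<partial>PiM ({..<n} - {i}) (\<lambda>j. gauss (if \<theta> j then \<mu> else 0))) \<le> 1" for \<theta>
  proof -
    interpret prob_space "PiM ({..<n} - {i}) (\<lambda>j. gauss (if \<theta> j then \<mu> else 0))"
      by (intro prob_space_PiM prob_space_gauss)
    have "(\<integral>\<^sup>+x. emeasure (K (x(i := y))) {d \<in> space (dec_space n). d i}
        \<partial>PiM ({..<n} - {i}) (\<lambda>j. gauss (if \<theta> j then \<mu> else 0)))
      \<le> (\<integral>\<^sup>+x. 1 \<partial>PiM ({..<n} - {i}) (\<lambda>j. gauss (if \<theta> j then \<mu> else 0)))"
      by (intro nn_integral_mono le)
    then show ?thesis by (simp add: emeasure_space_1)
  qed
  have "selection_prob n \<mu> p0 K i y \<le>
    (\<integral>\<^sup>+\<theta>. 1 \<partial>measure_pmf (Pi_pmf ({..<n} - {i}) False (\<lambda>_. bernoulli_pmf (1 - p0))))"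
    unfolding selection_prob_def by (intro nn_integral_mono in1)
  then show ?thesis by (simp add: measure_pmf.emeasure_space_1)
qed

section \<open>Events under the joint law\<close>

abbreviation joint_space :: "nat \<Rightarrow> ((nat \<Rightarrow> bool) \<times> (nat \<Rightarrow> real) \<times> (nat \<Rightarrow> bool)) measure" where
  "joint_space n \<equiv> count_space UNIV \<Otimes>\<^sub>M obs_space n \<Otimes>\<^sub>M dec_space n"

lemma sets_joint_event:
  assumes "i < n"
  shows "{w \<in> space (joint_space n). P (fst w i) (snd (snd w) i)} \<in> sets (joint_space n)"
proof -
  have [measurable]: "(\<lambda>w. fst w i) \<in> measurable (joint_space n) (count_space UNIV)"
    by (rule measurable_compose[OF measurable_fst]) simp
  have [measurable]: "(\<lambda>w. snd (snd w) i) \<in> measurable (joint_space n) (count_space UNIV)"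
    using assms
    by (intro measurable_compose[OF measurable_snd[THEN measurable_compose, OF measurable_snd] measurable_component_singleton]) simp
  show ?thesis by measurable
qed

text \<open>Unfolds the three monadic binds into an iterated integral; each stage has to be
  recognised as a probability kernel first.\<close>

lemma emeasure_joint_law:
  assumes K: "K \<in> decision_rules n" and E[measurable]: "E \<in> sets (joint_space n)"
  shows "emeasure (joint_law n \<mu> p0 K) E =
    (\<integral>\<^sup>+\<theta>. \<integral>\<^sup>+x. \<integral>\<^sup>+d. indicator E (\<theta>, x, d) \<partial>K x \<partial>obs_law n \<mu> \<theta> \<partial>theta_law n p0)"
proof -
  let ?J = "joint_space n"
  note [measurable] = K[unfolded decision_rules_def]
  have 1: "(\<lambda>x. K x \<bind> (\<lambda>d. return ?J (t, x, d))) \<in> obs_space n \<rightarrow>\<^sub>M prob_algebra ?J" for t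
    by measurable
  have 2: "obs_law n m t \<bind> (\<lambda>x. K x \<bind> (\<lambda>d. return ?J (t, x, d))) \<in> space (prob_algebra ?J)" for t m
    using prob_space_bind'[OF obs_law_prob_algebra 1] sets_bind'[OF obs_law_prob_algebra 1] by (simp add: space_prob_algebra)
  have 3: "theta_law n p0 \<in> space (prob_algebra (count_space UNIV))"
    unfolding theta_law_def by (simp add: space_prob_algebra measure_pmf.prob_space_axioms)
  have 4: "(\<lambda>t. obs_law n m t \<bind> (\<lambda>x. K x \<bind> (\<lambda>d. return ?J (t, x, d)))) \<in> count_space UNIV \<rightarrow>\<^sub>M prob_algebra ?J" for m
    using 2 by auto
  have 5: "emeasure (K x \<bind> (\<lambda>d. return ?J (t, x, d))) E = (\<integral>\<^sup>+d. indicator E (t, x, d) \<partial>K x)"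
    if "x \<in> space (obs_law n \<mu> t)" for x t
  proof -
    have sp: "space (obs_law n \<mu> t) = space (obs_space n)"
      using obs_law_prob_algebra[of n \<mu> t] by (auto simp: space_prob_algebra dest: sets_eq_imp_space_eq)
    have x[measurable]: "x \<in> space (obs_space n)" using that sp by simp
    have "K x \<in> space (prob_algebra (dec_space n))"
      using K x unfolding decision_rules_def by (rule measurable_space)
    moreover have "(\<lambda>d. return ?J (t, x, d)) \<in> dec_space n \<rightarrow>\<^sub>M prob_algebra ?J"
      by measurable
    ultimately have "emeasure (K x \<bind> (\<lambda>d. return ?J (t, x, d))) E = (\<integral>\<^sup>+d. emeasure (return ?J (t, x, d)) E \<partial>K x)"
      by (rule emeasure_bind_prob_algebra[OF _ _ E])
    then show ?thesis using E by simp
  qed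
  show ?thesis
    unfolding joint_law_def emeasure_bind_prob_algebra[OF 3 4 E] emeasure_bind_prob_algebra[OF obs_law_prob_algebra 1 E]
    by (intro nn_integral_cong 5)
qed

text \<open>Tonelli for the product measure with coordinate \<open>i\<close> split off. The override
  at \<open>i\<close> changes only that factor, so the remaining product can be written with
  \<theta> itself.\<close>

lemma nn_integral_obs_law:
  assumes "i < n" and f: "f \<in> borel_measurable (obs_space n)"
  shows "(\<integral>\<^sup>+x. f x \<partial>obs_law n \<mu> (\<theta>(i := b))) =
    (\<integral>\<^sup>+y. \<integral>\<^sup>+x. f (x(i := y)) \<partial>PiM ({..<n} - {i}) (\<lambda>j. gauss (if \<theta> j then \<mu> else 0))
       \<partial>gauss (if b then \<mu> else 0))"
proof -
  let ?M = "\<lambda>j. gauss (if (\<theta>(i := b)) j then \<mu> else 0)"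
  interpret product_sigma_finite ?M
    by standard (intro sigma_finite_measure.sigma_finite_countable prob_space_imp_sigma_finite prob_space_gauss)
  have ins: "insert i ({..<n} - {i}) = {..<n}" using assms by auto
  have f': "f \<in> borel_measurable (PiM (insert i ({..<n} - {i})) ?M)"
    using f by (simp only: ins measurable_cong_sets[OF sets_PiM_gauss refl])
  have *: "PiM ({..<n} - {i}) ?M = PiM ({..<n} - {i}) (\<lambda>j. gauss (if \<theta> j then \<mu> else 0))"
    by (intro PiM_cong) auto
  show ?thesis
    using product_nn_integral_insert_rev[OF _ _ f'] unfolding * ins by (simp add: obs_law_def)
qed

text \<open>The label \<open>b\<close> influences the selection of \<open>i\<close> only through the
  law of coordinate \<open>i\<close> of the observation. All remaining randomness is the same for
  both labels, which is why one function \<open>selection_prob\<close> serves for nulls and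
  signals.\<close>

lemma emeasure_joint_selected:
  assumes K: "K \<in> decision_rules n" and i: "i < n" and p0: "0 \<le> p0" "p0 \<le> 1"
  shows "emeasure (joint_law n \<mu> p0 K) {w \<in> space (joint_space n). fst w i = b \<and> snd (snd w) i} =
    ennreal (if b then 1 - p0 else p0) * (\<integral>\<^sup>+y. selection_prob n \<mu> p0 K i y \<partial>gauss (if b then \<mu> else 0))"
    (is "emeasure _ ?E = _")
proof -
  let ?S = "{d \<in> space (dec_space n). d i}"
  let ?R = "Pi_pmf ({..<n} - {i}) False (\<lambda>_. bernoulli_pmf (1 - p0))"
  let ?N = "gauss (if b then \<mu> else 0)"
  let ?G = "\<lambda>\<theta> y. \<integral>\<^sup>+x. emeasure (K (x(i := y))) ?S \<partial>PiM ({..<n} - {i}) (\<lambda>j. gauss (if \<theta> j then \<mu> else 0))"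
  have ins: "insert i ({..<n} - {i}) = {..<n}" using i by auto
  have Em: "?E \<in> sets (joint_space n)" using sets_joint_event[OF i, of "\<lambda>c d. c = b \<and> d"] by simp
  have KP: "K \<in> measurable (obs_space n) (subprob_algebra (dec_space n))"
    using K by (auto simp: decision_rules_def intro: measurable_prob_algebraD)
  have S: "?S \<in> sets (dec_space n)" using i by (rule sets_selected)
  have k: "(\<lambda>x. emeasure (K x) ?S) \<in> borel_measurable (obs_space n)"
    by (rule measurable_compose[OF KP measurable_emeasure_subprob_algebra[OF S]])
  have inner: "(\<integral>\<^sup>+d. indicator ?E (t, x, d) \<partial>K x) = of_bool (t i = b) * emeasure (K x) ?S"
    if "x \<in> space (obs_space n)" for x t
  proof -
    have sK: "sets (K x) = sets (dec_space n)" by (rule sets_kernel[OF KP that])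
    have spK: "space (K x) = space (dec_space n)" by (rule sets_eq_imp_space_eq[OF sK])
    have "(\<integral>\<^sup>+d. indicator ?E (t, x, d) \<partial>K x) = (\<integral>\<^sup>+d. of_bool (t i = b) * indicator ?S d \<partial>K x)"
      using that by (intro nn_integral_cong) (auto simp: spK space_pair_measure indicator_def)
    also have "\<dots> = of_bool (t i = b) * emeasure (K x) ?S"
      using S by (simp add: nn_integral_cmult sK)
    finally show ?thesis .
  qed
  have mid: "(\<integral>\<^sup>+x. \<integral>\<^sup>+d. indicator ?E (t, x, d) \<partial>K x \<partial>obs_law n \<mu> t) =
     of_bool (t i = b) * (\<integral>\<^sup>+x. emeasure (K x) ?S \<partial>obs_law n \<mu> t)" for t
  proof -
    have so: "sets (obs_law n \<mu> t) = sets (obs_space n)"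
      using obs_law_prob_algebra[of n \<mu> t] by (simp add: space_prob_algebra)
    have "(\<integral>\<^sup>+x. \<integral>\<^sup>+d. indicator ?E (t, x, d) \<partial>K x \<partial>obs_law n \<mu> t) =
      (\<integral>\<^sup>+x. of_bool (t i = b) * emeasure (K x) ?S \<partial>obs_law n \<mu> t)"
      by (intro nn_integral_cong inner) (simp add: sets_eq_imp_space_eq[OF so])
    then show ?thesis using k by (simp add: nn_integral_cmult measurable_cong_sets[OF so refl])
  qed
  have "emeasure (joint_law n \<mu> p0 K) ?E =
      (\<integral>\<^sup>+t. of_bool (t i = b) * (\<integral>\<^sup>+x. emeasure (K x) ?S \<partial>obs_law n \<mu> t) \<partial>theta_law n p0)"
    by (simp only: emeasure_joint_law[OF K Em] mid)
  \<comment> \<open>The label vector splits into its independent \<open>i\<close>-th entry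
    \<open>c\<close> and the remaining labels \<open>t\<close>.\<close>
  also have "\<dots> = (\<integral>\<^sup>+c. \<integral>\<^sup>+t. of_bool (c = b) * (\<integral>\<^sup>+x. emeasure (K x) ?S \<partial>obs_law n \<mu> (t(i := c))) \<partial>?R
        \<partial>bernoulli_pmf (1 - p0))"
    unfolding theta_law_def
    by (subst ins[symmetric], subst Pi_pmf_insert) (auto simp: nn_integral_pair_pmf')
  \<comment> \<open>The factor \<open>of_bool (c = b)\<close> kills every other label, so
    \<open>c\<close> may be frozen to \<open>b\<close> inside the observation law.\<close>
  also have "\<dots> = (\<integral>\<^sup>+c. of_bool (c = b) * (\<integral>\<^sup>+t. (\<integral>\<^sup>+x. emeasure (K x) ?S \<partial>obs_law n \<mu> (t(i := b))) \<partial>?R)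
        \<partial>bernoulli_pmf (1 - p0))"
    by (intro nn_integral_cong) auto
  also have "\<dots> = ennreal (if b then 1 - p0 else p0) * (\<integral>\<^sup>+t. (\<integral>\<^sup>+x. emeasure (K x) ?S \<partial>obs_law n \<mu> (t(i := b))) \<partial>?R)"
    using p0 by (cases b) (simp_all add: mult.commute)
  also have "(\<integral>\<^sup>+t. (\<integral>\<^sup>+x. emeasure (K x) ?S \<partial>obs_law n \<mu> (t(i := b))) \<partial>?R) = (\<integral>\<^sup>+t. \<integral>\<^sup>+y. ?G t y \<partial>?N \<partial>?R)"
    by (intro nn_integral_cong nn_integral_obs_law i k)
  also have "\<dots> = (\<integral>\<^sup>+y. \<integral>\<^sup>+t. ?G t y \<partial>?R \<partial>?N)"
  proof -
    have G: "?G t \<in> borel_measurable ?N" for t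
      using borel_measurable_nn_integral_kernel_upd[OF K i] by simp
    have fin: "finite (set_pmf ?R)" by (intro finite_set_theta) auto
    show ?thesis
      using G by (simp add: nn_integral_measure_pmf_finite[OF fin] nn_integral_sum nn_integral_multc)
  qed
  finally show ?thesis by (simp only: selection_prob_def)
qed

subsection \<open>Likelihood-ratio bounds on the power of a test\<close>

text \<open>Completing the square: for \<open>f\<close>, \<open>g\<close> the densities of N(a,1),
  N(b,1), the function \<open>g ^ (k + 1) / f ^ k\<close> is a constant times a shifted normal
  density. That constant is the moment of order \<open>k + 1\<close> of the likelihood ratio under
  N(a,1). The case \<open>k = 1\<close> gives the chi-square divergence, \<open>k = 2\<close> the
  third moment.\<close>

lemma normal_density_power_ratio:
  "normal_density b 1 x ^ Suc k = exp (real k * (real k + 1) * (b - a)\<^sup>2 / 2) *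
     normal_density (a + (real k + 1) * (b - a)) 1 x * normal_density a 1 x ^ k"
proof -
  let ?c = "1 / sqrt (2 * pi)"
  have e: "real (Suc k) * (- (x - b)\<^sup>2 / 2) = real k * (real k + 1) * (b - a)\<^sup>2 / 2
      + - (x - (a + (real k + 1) * (b - a)))\<^sup>2 / 2 + real k * (- (x - a)\<^sup>2 / 2)"
    by (simp add: field_simps power2_eq_square)
  have "exp (- (x - b)\<^sup>2 / 2) ^ Suc k = exp (real k * (real k + 1) * (b - a)\<^sup>2 / 2)
      * exp (- (x - (a + (real k + 1) * (b - a)))\<^sup>2 / 2) * exp (- (x - a)\<^sup>2 / 2) ^ k"
    unfolding exp_of_nat_mult[symmetric] e exp_add by simp
  then have "?c ^ Suc k * exp (- (x - b)\<^sup>2 / 2) ^ Suc k = ?c ^ Suc k * (exp (real k * (real k + 1) * (b - a)\<^sup>2 / 2)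
      * exp (- (x - (a + (real k + 1) * (b - a)))\<^sup>2 / 2) * exp (- (x - a)\<^sup>2 / 2) ^ k)"
    by (simp only:)
  then show ?thesis
    by (simp add: normal_density_def power_divide mult_ac)
qed

definition test_functions :: "(real \<Rightarrow> real) set" where
  "test_functions = {\<psi> \<in> borel_measurable borel. \<forall>x. 0 \<le> \<psi> x \<and> \<psi> x \<le> 1}"

lemma integrable_test:
  assumes "\<psi> \<in> test_functions"
  shows "integrable (gauss m) \<psi>"
proof -
  interpret prob_space "gauss m" by (rule prob_space_gauss)
  show ?thesis using assms unfolding test_functions_def
    by (intro integrable_const_bound[where B=1]) auto
qed

lemma integral_gauss:
  assumes "\<psi> \<in> borel_measurable borel"
  shows "(LINT x|gauss m. \<psi> x) = (LBINT x. normal_density m 1 x * \<psi> x)"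
  using assms by (simp add: integral_density)

lemma integrable_normal_mult:
  assumes "\<psi> \<in> test_functions"
  shows "integrable lborel (\<lambda>x. normal_density m 1 x * \<psi> x)"
  using integrable_test[OF assms, of m]
  by (subst (asm) integrable_density) (use assms in \<open>auto simp: test_functions_def\<close>)

lemma test_integral_bounds:
  assumes "\<psi> \<in> test_functions"
  shows "0 \<le> (LINT x|gauss m. \<psi> x)" "(LINT x|gauss m. \<psi> x) \<le> 1"
proof -
  interpret prob_space "gauss m" by (rule prob_space_gauss)
  show "0 \<le> (LINT x|gauss m. \<psi> x)" using assms by (intro integral_nonneg_AE) (auto simp: test_functions_def)
  have "(LINT x|gauss m. \<psi> x) \<le> (LINT x|gauss m. 1)"
    using assms by (intro integral_mono integrable_test) (auto simp: test_functions_def)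
  then show "(LINT x|gauss m. \<psi> x) \<le> 1" using prob_space by simp
qed

text \<open>The bound integrates \<open>r \<le> c + r\<^sup>3 / c\<^sup>2\<close> for the likelihood ratio \<open>r\<close>.\<close>

lemma power_tail_bound:
  assumes "\<psi> \<in> test_functions" "0 < c"
  shows "(LINT x|gauss b. \<psi> x) \<le> c * (LINT x|gauss a. \<psi> x) + exp (3 * (b - a)\<^sup>2) / c\<^sup>2"
proof -
  let ?f = "normal_density a 1" and ?g = "normal_density b 1"
    and ?h = "normal_density (a + 3 * (b - a)) 1"
  let ?E = "exp (3 * (b - a)\<^sup>2)"
  have pt: "?g x * \<psi> x \<le> c * (?f x * \<psi> x) + ?E / c\<^sup>2 * ?h x" for x
  proof (cases "?g x \<le> c * ?f x")
    case True
    have "?g x * \<psi> x \<le> c * ?f x * \<psi> x"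
      using True assms by (intro mult_right_mono) (auto simp: test_functions_def)
    then show ?thesis by (simp add: algebra_simps add_increasing2)
  next
    case False
    have f: "0 < ?f x" by (simp add: normal_density_pos)
    have "(c * ?f x)\<^sup>2 \<le> ?g x ^ 2"
      using False f assms(2) by (intro power_mono) auto
    then have "?g x * (c * ?f x)\<^sup>2 \<le> ?g x * ?g x ^ 2"
      by (intro mult_left_mono) auto
    also have "\<dots> = ?g x ^ Suc 2" by (simp only: power_Suc)
    also have "\<dots> = ?E * ?h x * ?f x ^ 2"
      using normal_density_power_ratio[of b x 2 a] by (simp add: algebra_simps)
    finally have "?g x * c\<^sup>2 \<le> ?E * ?h x"
      using f by (simp add: power_mult_distrib)
    then have "?g x \<le> ?E / c\<^sup>2 * ?h x" using assms(2) by (simp add: field_simps)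
    moreover have "?g x * \<psi> x \<le> ?g x" "0 \<le> c * (?f x * \<psi> x)"
      using assms by (auto simp: test_functions_def mult_left_le)
    ultimately show ?thesis by linarith
  qed
  have m: "\<psi> \<in> borel_measurable borel" using assms by (simp add: test_functions_def)
  have "(LBINT x. ?g x * \<psi> x) \<le> (LBINT x. c * (?f x * \<psi> x) + ?E / c\<^sup>2 * ?h x)"
    using assms(1) by (intro integral_mono pt Bochner_Integration.integrable_add integrable_mult_right integrable_normal_mult) auto
  also have "\<dots> = c * (LBINT x. ?f x * \<psi> x) + ?E / c\<^sup>2"
    using integrable_normal_mult[OF assms(1), of a] by (subst Bochner_Integration.integral_add) (auto simp del: divide_const_simps)
  finally show ?thesis by (simp add: integral_gauss[OF m])
qed

text \<open>Cauchy-Schwarz for \<psi> and the centred likelihood ratio, whose variance under N(a,1)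
  is the chi-square divergence \<open>exp ((b - a)\<^sup>2) - 1\<close>. It is carried out as a
  quadratic inequality in a free parameter \<open>t\<close>.\<close>

lemma test_chi_square:
  assumes "\<psi> \<in> test_functions"
  shows "((LINT x|gauss b. \<psi> x) - (LINT x|gauss a. \<psi> x))\<^sup>2
    \<le> (exp ((b - a)\<^sup>2) - 1) * (LINT x|gauss a. \<psi> x)"
proof -
  let ?f = "normal_density a 1" and ?g = "normal_density b 1"
    and ?h = "normal_density (a + 2 * (b - a)) 1"
  define A where "A = (LINT x|gauss a. \<psi> x)"
  define D where "D = (LINT x|gauss b. \<psi> x) - A"
  define C where "C = exp ((b - a)\<^sup>2) - 1"
  have m: "\<psi> \<in> borel_measurable borel" using assms by (simp add: test_functions_def)
  have Ai: "A = (LBINT x. ?f x * \<psi> x)" by (simp add: A_def integral_gauss[OF m])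
  have Di: "D = (LBINT x. ?g x * \<psi> x) - (LBINT x. ?f x * \<psi> x)" by (simp add: D_def Ai integral_gauss[OF m])
  \<comment> \<open>with \<open>f\<close>, \<open>g\<close> the densities of \<open>N(a,1)\<close>, \<open>N(b,1)\<close>, integrate \<open>(t \<psi> - (g/f - 1))\<^sup>2 f \<ge> 0\<close>, using \<open>\<psi>\<^sup>2 \<le> \<psi>\<close>\<close>
  have quad: "2 * t * D \<le> t\<^sup>2 * A + C" for t
  proof -
    have pt: "2 * t * (?g x * \<psi> x - ?f x * \<psi> x) \<le> t\<^sup>2 * (?f x * \<psi> x) + ((C + 1) * ?h x - 2 * ?g x + ?f x)" for x
    proof -
      have f: "0 < ?f x" by (simp add: normal_density_pos)
      have g: "?g x ^ 2 = (C + 1) * ?h x * ?f x"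
        using normal_density_power_ratio[of b x 1 a] by (simp add: C_def power2_eq_square[of "normal_density b 1 x"])
      have p: "0 \<le> \<psi> x" "\<psi> x \<le> 1" using assms by (auto simp: test_functions_def)
      \<comment> \<open>The square is scaled by \<open>f\<^sup>2\<close>, so that no division by the
        density occurs; one factor \<open>f\<close> is cancelled at the end.\<close>
      have "0 \<le> (t * \<psi> x * ?f x - (?g x - ?f x))\<^sup>2" by simp
      also have "\<dots> = t\<^sup>2 * (\<psi> x)\<^sup>2 * ?f x ^ 2 - 2 * t * \<psi> x * ?f x * (?g x - ?f x) + (?g x ^ 2 - 2 * ?g x * ?f x + ?f x ^ 2)"
        by (simp add: power2_eq_square algebra_simps)
      also have "\<dots> \<le> t\<^sup>2 * \<psi> x * ?f x ^ 2 - 2 * t * \<psi> x * ?f x * (?g x - ?f x) + (?g x ^ 2 - 2 * ?g x * ?f x + ?f x ^ 2)"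
        using p by (intro add_right_mono diff_right_mono mult_right_mono mult_left_mono) (auto simp: power2_eq_square mult_left_le)
      also have "\<dots> = ?f x * (t\<^sup>2 * (?f x * \<psi> x) + ((C + 1) * ?h x - 2 * ?g x + ?f x) - 2 * t * (?g x * \<psi> x - ?f x * \<psi> x))"
        unfolding g by (simp add: power2_eq_square algebra_simps)
      finally show ?thesis using f by (simp add: zero_le_mult_iff)
    qed
    have "(LBINT x. 2 * t * (?g x * \<psi> x - ?f x * \<psi> x)) \<le>
        (LBINT x. t\<^sup>2 * (?f x * \<psi> x) + ((C + 1) * ?h x - 2 * ?g x + ?f x))"
      using assms by (intro integral_mono pt Bochner_Integration.integrable_add Bochner_Integration.integrable_diff
          integrable_mult_right integrable_normal_mult) auto
    moreover have "(LBINT x. 2 * t * (?g x * \<psi> x - ?f x * \<psi> x)) = 2 * t * D"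
      unfolding Di using integrable_normal_mult[OF assms] by simp
    moreover have "(LBINT x. t\<^sup>2 * (?f x * \<psi> x) + ((C + 1) * ?h x - 2 * ?g x + ?f x)) = t\<^sup>2 * A + C"
      unfolding Ai using integrable_normal_mult[OF assms, of a] by simp
    ultimately show ?thesis by (simp only:)
  qed
  have A0: "0 \<le> A" unfolding A_def by (rule test_integral_bounds[OF assms])
  have C0: "0 \<le> C" by (simp add: C_def)
  have "D\<^sup>2 \<le> C * A"
  proof (cases "A = 0")
    case True
    have "D = 0"
    proof (rule ccontr)
      assume "D \<noteq> 0"
      \<comment> \<open>With \<open>A = 0\<close> the bound reads \<open>2 * t * D \<le> C\<close>
        for all \<open>t\<close>; this \<open>t\<close> makes the left side
        \<open>C + 1\<close>.\<close>
      then show False using quad[of "(C + 1) / (2 * D)"] True by simp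
    qed
    then show ?thesis using True by simp
  next
    case False
    then have "0 < A" using A0 by simp
    \<comment> \<open>\<open>t = D / A\<close> maximises
      \<open>2 * t * D - t\<^sup>2 * A\<close>.\<close>
    then show ?thesis using quad[of "D / A"] by (simp add: field_simps power2_eq_square)
  qed
  then show ?thesis by (simp add: A_def D_def C_def)
qed

text \<open>The previous bound for the test \<open>1 - \<psi>\<close> with the two means exchanged:
  the squared difference is unchanged and the size becomes the miss probability of \<psi>.\<close>

lemma test_chi_square_complement:
  assumes "\<psi> \<in> test_functions"
  shows "((LINT x|gauss b. \<psi> x) - (LINT x|gauss a. \<psi> x))\<^sup>2
    \<le> (exp ((b - a)\<^sup>2) - 1) * (1 - (LINT x|gauss b. \<psi> x))"
proof -
  have c: "(\<lambda>x. 1 - \<psi> x) \<in> test_functions"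
    using assms by (auto simp: test_functions_def)
  have i: "(LINT x|gauss m. 1 - \<psi> x) = 1 - (LINT x|gauss m. \<psi> x)" for m
  proof -
    interpret prob_space "gauss m" by (rule prob_space_gauss)
    show ?thesis using integrable_test[OF assms, of m] prob_space by (simp add: Bochner_Integration.integral_diff)
  qed
  show ?thesis
    using test_chi_square[OF c, of a b] by (simp add: i power2_commute[of a b])
qed

subsection \<open>Error rates in terms of size and power\<close>

text \<open>Observation and decision are drawn from kernels of total mass one, so they integrate out
  and leave the Bernoulli marginal.\<close>

lemma measure_joint_theta:
  assumes K: "K \<in> decision_rules n" and i: "i < n" and p0: "0 \<le> p0" "p0 \<le> 1"
  shows "measure (joint_law n \<mu> p0 K) {w \<in> space (joint_space n). fst w i} = 1 - p0"
proof -
  let ?E = "{w \<in> space (joint_space n). fst w i}"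
  have Em: "?E \<in> sets (joint_space n)" using sets_joint_event[OF i, of "\<lambda>c d. c"] by simp
  have inner: "(\<integral>\<^sup>+x. \<integral>\<^sup>+d. indicator ?E (t, x, d) \<partial>K x \<partial>obs_law n \<mu> t) = of_bool (t i)" for t
  proof -
    interpret X: prob_space "obs_law n \<mu> t"
      using obs_law_prob_algebra by (simp add: space_prob_algebra)
    have so: "space (obs_law n \<mu> t) = space (obs_space n)"
      using obs_law_prob_algebra[of n \<mu> t] by (auto simp: space_prob_algebra dest: sets_eq_imp_space_eq)
    have "(\<integral>\<^sup>+d. indicator ?E (t, x, d) \<partial>K x) = of_bool (t i)" if "x \<in> space (obs_law n \<mu> t)" for x
    proof -
      have x: "x \<in> space (obs_space n)" using that so by simp
      have "K x \<in> space (prob_algebra (dec_space n))"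
        using K x unfolding decision_rules_def by (rule measurable_space)
      then have sK: "sets (K x) = sets (dec_space n)" and "prob_space (K x)"
        by (auto simp: space_prob_algebra)
      interpret prob_space "K x" by fact
      have "(\<integral>\<^sup>+d. indicator ?E (t, x, d) \<partial>K x) = (\<integral>\<^sup>+d. of_bool (t i) \<partial>K x)"
        using x by (intro nn_integral_cong) (auto simp: sets_eq_imp_space_eq[OF sK] space_pair_measure indicator_def)
      then show ?thesis by (simp add: emeasure_space_1)
    qed
    then have "(\<integral>\<^sup>+x. \<integral>\<^sup>+d. indicator ?E (t, x, d) \<partial>K x \<partial>obs_law n \<mu> t) = (\<integral>\<^sup>+x. of_bool (t i) \<partial>obs_law n \<mu> t)"
      by (intro nn_integral_cong)
    then show ?thesis by (simp add: X.emeasure_space_1)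
  qed
  have "emeasure (joint_law n \<mu> p0 K) ?E =
      (\<integral>\<^sup>+t. of_bool (t i) \<partial>measure_pmf (Pi_pmf {..<n} False (\<lambda>_. bernoulli_pmf (1 - p0))))"
    by (simp only: emeasure_joint_law[OF K Em] inner theta_law_def)
  also have "\<dots> = (\<integral>\<^sup>+c. of_bool c \<partial>measure_pmf (map_pmf (\<lambda>t. t i) (Pi_pmf {..<n} False (\<lambda>_. bernoulli_pmf (1 - p0)))))"
    by simp
  also have "\<dots> = ennreal (1 - p0)"
    using i p0 by (subst Pi_pmf_component) simp_all
  finally show ?thesis using p0 by (simp add: measure_def)
qed

section \<open>Averaging over coordinates\<close>

definition average_test ::
  "nat \<Rightarrow> real \<Rightarrow> real \<Rightarrow> ((nat \<Rightarrow> real) \<Rightarrow> (nat \<Rightarrow> bool) measure) \<Rightarrow> real \<Rightarrow> real" where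
  "average_test n \<mu> p0 K y = (\<Sum>i<n. enn2real (selection_prob n \<mu> p0 K i y)) / real n"

lemma selection_prob_test_function:
  assumes "K \<in> decision_rules n" "i < n"
  shows "(\<lambda>y. enn2real (selection_prob n \<mu> p0 K i y)) \<in> test_functions"
  using borel_measurable_selection_prob[OF assms] enn2real_mono[OF selection_prob_le_1[OF assms]]
  by (auto simp: test_functions_def intro!: measurable_compose[OF _ borel_measurable_enn2real])

lemma average_test_test_function:
  assumes K: "K \<in> decision_rules n"
  shows "average_test n \<mu> p0 K \<in> test_functions"
proof -
  have "(\<Sum>i<n. enn2real (selection_prob n \<mu> p0 K i y)) \<le> (\<Sum>i<n. 1)" for y
    using selection_prob_test_function[OF K, of _ \<mu> p0] by (intro sum_mono) (auto simp: test_functions_def)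
  moreover have "average_test n \<mu> p0 K \<in> borel_measurable borel"
    unfolding average_test_def[abs_def]
    using selection_prob_test_function[OF K, of _ \<mu> p0] by (intro borel_measurable_divide borel_measurable_sum) (auto simp: test_functions_def)
  ultimately show ?thesis
    by (auto simp: test_functions_def average_test_def divide_simps intro!: sum_nonneg divide_nonneg_nonneg)
qed

lemma measure_joint_selected:
  assumes K: "K \<in> decision_rules n" and i: "i < n" and p0: "0 \<le> p0" "p0 \<le> 1"
  shows "measure (joint_law n \<mu> p0 K) {w \<in> space (joint_space n). fst w i = b \<and> snd (snd w) i} =
    (if b then 1 - p0 else p0) * (LINT y|gauss (if b then \<mu> else 0). enn2real (selection_prob n \<mu> p0 K i y))"
proof -
  have fin: "selection_prob n \<mu> p0 K i y < \<top>" for y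
    using selection_prob_le_1[OF K i, of \<mu> p0 y] by (simp add: le_less_trans)
  have "(LINT y|gauss (if b then \<mu> else 0). enn2real (selection_prob n \<mu> p0 K i y)) =
     enn2real (\<integral>\<^sup>+y. ennreal (enn2real (selection_prob n \<mu> p0 K i y)) \<partial>gauss (if b then \<mu> else 0))"
    using selection_prob_test_function[OF K i, of \<mu> p0] by (intro integral_eq_nn_integral) (auto simp: test_functions_def)
  then show ?thesis
    unfolding measure_def emeasure_joint_selected[OF K i p0] using p0 fin
    by (simp add: enn2real_mult)
qed

text \<open>Every numerator and denominator in \<open>mFDR\<close>, \<open>mFNR\<close> and
  \<open>EFN\<close> is a sum of this shape, so each expectation is obtained by choosing the four
  coefficients.\<close>

lemma joint_expectation_linear:
  assumes K: "K \<in> decision_rules n" and p0: "0 \<le> p0" "p0 \<le> 1"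
  shows "joint_expectation n \<mu> p0 K (\<lambda>\<theta> d. \<Sum>i<n. c + c1 * of_bool (\<theta> i) + c2 * of_bool (d i \<and> \<theta> i) + c3 * of_bool (d i \<and> \<not> \<theta> i)) =
    real n * (c + c1 * (1 - p0) + c2 * ((1 - p0) * (LINT y|gauss \<mu>. average_test n \<mu> p0 K y))
      + c3 * (p0 * (LINT y|gauss 0. average_test n \<mu> p0 K y)))"
proof -
  let ?J = "joint_law n \<mu> p0 K"
  let ?T = "\<lambda>i. {w \<in> space (joint_space n). fst w i}"
  let ?E = "\<lambda>i b. {w \<in> space (joint_space n). fst w i = b \<and> snd (snd w) i}"
  let ?s = "\<lambda>i y. enn2real (selection_prob n \<mu> p0 K i y)"
  have JP: "?J \<in> space (prob_algebra (joint_space n))" by (rule joint_law_prob_algebra[OF K])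
  then interpret prob_space ?J by (simp add: space_prob_algebra)
  have sJ: "sets ?J = sets (joint_space n)" using JP by (simp add: space_prob_algebra)
  note spJ = sets_eq_imp_space_eq[OF sJ]
  have T: "?T i \<in> sets ?J" if "i < n" for i
    using sets_joint_event[OF that, of "\<lambda>c d. c"] by (simp add: sJ)
  have E: "?E i b \<in> sets ?J" if "i < n" for i b
    using sets_joint_event[OF that, of "\<lambda>c d. c = b \<and> d"] by (simp add: sJ)
  have I: "integrable ?J (\<lambda>w. r * indicator X w)" if "X \<in> sets ?J" for X and r :: real
    using that by (intro integrable_mult_right integrable_real_indicator) (auto simp: less_top[symmetric])
  have L: "(LINT w|?J. r * indicator X w) = r * measure ?J X" if "X \<in> sets ?J" for X and r :: real
    using that by simp
  have "joint_expectation n \<mu> p0 K (\<lambda>\<theta> d. \<Sum>i<n. c + c1 * of_bool (\<theta> i) + c2 * of_bool (d i \<and> \<theta> i) + c3 * of_bool (d i \<and> \<not> \<theta> i))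
    = (LINT w|?J. (\<Sum>i<n. c + c1 * indicator (?T i) w + c2 * indicator (?E i True) w + c3 * indicator (?E i False) w))"
    unfolding joint_expectation_def
    by (intro Bochner_Integration.integral_cong refl) (auto simp: spJ case_prod_beta indicator_def intro!: sum.cong)
  also have "\<dots> = (\<Sum>i<n. (LINT w|?J. c + c1 * indicator (?T i) w + c2 * indicator (?E i True) w + c3 * indicator (?E i False) w))"
    using T E by (intro Bochner_Integration.integral_sum Bochner_Integration.integrable_add integrable_const I) (simp_all only: lessThan_iff)
  also have "\<dots> = (\<Sum>i<n. c + c1 * measure ?J (?T i) + c2 * measure ?J (?E i True) + c3 * measure ?J (?E i False))"
  proof (intro sum.cong refl)
    fix i assume "i \<in> {..<n}"
    then have i: "i < n" by simp
    show "(LINT w|?J. c + c1 * indicator (?T i) w + c2 * indicator (?E i True) w + c3 * indicator (?E i False) w)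
      = c + c1 * measure ?J (?T i) + c2 * measure ?J (?E i True) + c3 * measure ?J (?E i False)"
      by (simp only: Bochner_Integration.integral_add Bochner_Integration.integrable_add I[OF T[OF i]] I[OF E[OF i]]
          integrable_const L[OF T[OF i]] L[OF E[OF i]] lebesgue_integral_const prob_space real_scaleR_def mult_1)
  qed
  also have "\<dots> = (\<Sum>i<n. c + c1 * (1 - p0) + c2 * ((1 - p0) * (LINT y|gauss \<mu>. ?s i y)) + c3 * (p0 * (LINT y|gauss 0. ?s i y)))"
    using measure_joint_selected[OF K _ p0, of _ \<mu> True] measure_joint_selected[OF K _ p0, of _ \<mu> False]
    by (intro sum.cong refl) (simp add: measure_joint_theta[OF K _ p0])
  also have "\<dots> = real n * (c + c1 * (1 - p0)) + c2 * ((1 - p0) * (\<Sum>i<n. (LINT y|gauss \<mu>. ?s i y))) + c3 * (p0 * (\<Sum>i<n. (LINT y|gauss 0. ?s i y)))"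
    by (simp add: sum.distrib sum_distrib_left distrib_left)
  also have "\<dots> = real n * (c + c1 * (1 - p0) + c2 * ((1 - p0) * (LINT y|gauss \<mu>. average_test n \<mu> p0 K y))
      + c3 * (p0 * (LINT y|gauss 0. average_test n \<mu> p0 K y)))"
  proof -
    have "real n * (LINT y|gauss m. average_test n \<mu> p0 K y) = (\<Sum>i<n. (LINT y|gauss m. ?s i y))" for m
    proof (cases "n = 0")
      case False
      then show ?thesis
        unfolding average_test_def
        using integrable_test[OF selection_prob_test_function[OF K, of _ \<mu> p0], of _ m]
        by (simp add: Bochner_Integration.integral_sum)
    qed simp
    note * = this[symmetric]
    show ?thesis unfolding * by (simp add: algebra_simps)
  qed
  finally show ?thesis .
qed

context
  fixes n :: nat and \<mu> p0 :: real and K and A B :: real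
  assumes K: "K \<in> decision_rules n" and p0: "0 < p0" "p0 < 1" and n: "1 \<le> n"
  defines "A \<equiv> LINT y|gauss 0. average_test n \<mu> p0 K y"
    and "B \<equiv> LINT y|gauss \<mu>. average_test n \<mu> p0 K y"
begin

lemma mFDR_eq: "mFDR n \<mu> p0 K = p0 * A / (p0 * A + (1 - p0) * B)"
proof -
  have 1: "joint_expectation n \<mu> p0 K (\<lambda>\<theta> d. \<Sum>i<n. of_bool (d i) * (1 - of_bool (\<theta> i))) = real n * (p0 * A)"
    using joint_expectation_linear[OF K, of p0 \<mu> 0 0 0 1] p0
    by (simp add: A_def B_def of_bool_conj of_bool_not_iff)
  have "of_bool (d \<and> t) + of_bool (d \<and> \<not> t) = (of_bool d :: real)" for d t by simp
  then have 2: "joint_expectation n \<mu> p0 K (\<lambda>\<theta> d. \<Sum>i<n. of_bool (d i)) = real n * ((1 - p0) * B + p0 * A)"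
    using joint_expectation_linear[OF K, of p0 \<mu> 0 0 1 1] p0 by (simp add: A_def B_def)
  show ?thesis unfolding mFDR_def 1 2 using n by (simp add: add.commute)
qed

lemma expected_misses:
  "joint_expectation n \<mu> p0 K (\<lambda>\<theta> d. \<Sum>i<n. (1 - of_bool (d i)) * of_bool (\<theta> i)) = real n * ((1 - p0) * (1 - B))"
proof -
  have "of_bool t - of_bool (d \<and> t) = (1 - of_bool d) * (of_bool t :: real)" for d t by simp
  then show ?thesis
    using joint_expectation_linear[OF K, of p0 \<mu> 0 1 "-1" 0] p0 by (simp add: A_def B_def algebra_simps)
qed

lemma mFNR_eq: "mFNR n \<mu> p0 K = (1 - p0) * (1 - B) / (p0 * (1 - A) + (1 - p0) * (1 - B))"
proof -
  have key: "1 + 0 * of_bool t + - 1 * of_bool (d \<and> t) + - 1 * of_bool (d \<and> \<not> t) = (1 - of_bool d :: real)" for d t by simp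
  then have 2: "joint_expectation n \<mu> p0 K (\<lambda>\<theta> d. \<Sum>i<n. 1 - of_bool (d i)) = real n * (1 - (1 - p0) * B - p0 * A)"
    using joint_expectation_linear[OF K, of p0 \<mu> 1 0 "- 1" "- 1", unfolded key] p0 by (simp add: A_def B_def)
  have "1 - (1 - p0) * B - p0 * A = p0 * (1 - A) + (1 - p0) * (1 - B)" by (simp add: algebra_simps)
  then show ?thesis unfolding mFNR_def expected_misses 2 using n by simp
qed

lemma EFN_eq: "EFN n \<mu> p0 K = (1 - p0) * (1 - B)"
  unfolding EFN_def using expected_misses n by (simp add: mult.commute)

end

subsection \<open>Small levels\<close>

text \<open>Clearing the denominator makes the constraint linear in \<open>(A, B)\<close>. If the
  denominator is 0, then \<open>A\<close> and \<open>B\<close> both vanish and the linear form holds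
  trivially.\<close>

lemma false_discovery_constraint:
  assumes "0 \<le> A" "0 \<le> B" "0 < p0" "p0 < 1" "p0 * A / (p0 * A + (1 - p0) * B) \<le> (\<alpha>::real)"
  shows "p0 * A * (1 - \<alpha>) \<le> \<alpha> * (1 - p0) * B"
proof (cases "p0 * A + (1 - p0) * B = 0")
  case True
  have "0 \<le> p0 * A" "0 \<le> (1 - p0) * B" using assms by auto
  then have "p0 * A = 0" "(1 - p0) * B = 0" using True by linarith+
  then show ?thesis using assms by auto
next
  case False
  moreover have "0 \<le> p0 * A" "0 \<le> (1 - p0) * B" using assms by auto
  ultimately have "0 < p0 * A + (1 - p0) * B" by linarith
  then have "p0 * A \<le> \<alpha> * (p0 * A + (1 - p0) * B)" using assms(5) by (simp add: pos_divide_le_eq)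
  then show ?thesis by (simp add: algebra_simps)
qed

lemma power_quadratic_bound:
  assumes \<psi>: "\<psi> \<in> test_functions" and p0: "0 < p0" "p0 < 1" and \<alpha>: "0 < \<alpha>" "\<alpha> \<le> 1/2"
    and c: "p0 * (LINT x|gauss 0. \<psi> x) * (1 - \<alpha>) \<le> \<alpha> * (1 - p0) * (LINT x|gauss \<mu>. \<psi> x)"
  shows "(LINT x|gauss \<mu>. \<psi> x) \<le> 8 * exp (3 * \<mu>\<^sup>2) * (2 * (1 - p0) / p0)\<^sup>2 * \<alpha>\<^sup>2"
proof -
  define A where "A = (LINT x|gauss 0. \<psi> x)"
  define B where "B = (LINT x|gauss \<mu>. \<psi> x)"
  \<comment> \<open>The factor 2 pays for replacing \<open>1 - \<alpha>\<close> by its lower bound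
    1/2.\<close>
  define k where "k = 2 * (1 - p0) / p0"
  have k: "0 < k" using p0 by (simp add: k_def)
  have A: "0 \<le> A" unfolding A_def by (rule test_integral_bounds[OF \<psi>])
  have "p0 * A * (1/2) \<le> p0 * A * (1 - \<alpha>)" using A p0 \<alpha> by (intro mult_left_mono) auto
  then have "p0 * A * (1/2) \<le> \<alpha> * (1 - p0) * B" using c by (simp add: A_def B_def)
  then have AB: "A \<le> k * \<alpha> * B" using p0 by (simp add: k_def field_simps)
  \<comment> \<open>This choice of \<open>c\<close> in the tail bound makes
    \<open>c * A \<le> B / 2\<close>, which is absorbed on the left; the remaining term is of order
    \<open>\<alpha>\<^sup>2\<close>.\<close>
  have "B \<le> 1 / (2 * k * \<alpha>) * A + exp (3 * \<mu>\<^sup>2) / (1 / (2 * k * \<alpha>))\<^sup>2"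
    using power_tail_bound[OF \<psi>, of "1 / (2 * k * \<alpha>)" \<mu> 0] k \<alpha> by (simp add: A_def B_def)
  also have "1 / (2 * k * \<alpha>) * A \<le> 1 / (2 * k * \<alpha>) * (k * \<alpha> * B)"
    using AB k \<alpha> by (intro mult_left_mono) auto
  also have "1 / (2 * k * \<alpha>) * (k * \<alpha> * B) = B / 2" using k \<alpha> by simp
  also have "exp (3 * \<mu>\<^sup>2) / (1 / (2 * k * \<alpha>))\<^sup>2 = exp (3 * \<mu>\<^sup>2) * (4 * k\<^sup>2 * \<alpha>\<^sup>2)"
    using k \<alpha> by (simp add: power_divide power_mult_distrib)
  finally show ?thesis unfolding B_def[symmetric] k_def[symmetric] by simp
qed

section \<open>Threshold rules and feasibility\<close>

text \<open>A deterministic rule as a Dirac kernel. \<open>T = {}\<close> gives the rule that never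
  selects, \<open>T = {z<..}\<close> the one-sided threshold test.\<close>

definition threshold_rule :: "nat \<Rightarrow> real set \<Rightarrow> (nat \<Rightarrow> real) \<Rightarrow> (nat \<Rightarrow> bool) measure" where
  "threshold_rule n T x = return (dec_space n) (\<lambda>i\<in>{..<n}. x i \<in> T)"

lemma threshold_rule_decision_rules:
  assumes T: "T \<in> sets borel"
  shows "threshold_rule n T \<in> decision_rules n"
proof -
  have "(\<lambda>x. \<lambda>i\<in>{..<n}. x i \<in> T) \<in> measurable (obs_space n) (dec_space n)"
  proof (intro measurable_restrict)
    fix i assume i: "i \<in> {..<n}"
    have "(\<lambda>y. y \<in> T) \<in> measurable borel (count_space UNIV)" using T by measurable
    from measurable_compose[OF measurable_component_singleton[OF i] this]
    show "(\<lambda>x. x i \<in> T) \<in> measurable (obs_space n) (count_space UNIV)" .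
  qed
  from measurable_compose[OF this measurable_return_prob_space]
  show ?thesis by (simp add: decision_rules_def threshold_rule_def[abs_def])
qed

text \<open>The decision on \<open>i\<close> depends on coordinate \<open>i\<close> alone, so
  averaging over the other coordinates leaves the indicator unchanged.\<close>

lemma average_test_threshold_rule:
  assumes n: "1 \<le> n"
  shows "average_test n \<mu> p0 (threshold_rule n T) = indicator T"
proof
  fix y
  have "selection_prob n \<mu> p0 (threshold_rule n T) i y = indicator T y" if i: "i < n" for i
  proof -
    have "emeasure (threshold_rule n T (x(i := y))) {d \<in> space (dec_space n). d i} = indicator T y" for x
      using i unfolding threshold_rule_def
      by (subst emeasure_return[OF sets_selected[OF i]]) (auto simp: indicator_def space_PiM)
    moreover have "emeasure (PiM ({..<n} - {i}) (\<lambda>j. gauss (if \<theta> j then \<mu> else 0)))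
        (space (PiM ({..<n} - {i}) (\<lambda>j. gauss (if \<theta> j then \<mu> else 0)))) = 1" for \<theta>
      by (intro prob_space.emeasure_space_1 prob_space_PiM prob_space_gauss)
    ultimately show ?thesis
      by (simp add: selection_prob_def measure_pmf.emeasure_space_1)
  qed
  then show "average_test n \<mu> p0 (threshold_rule n T) y = indicator T y"
    using n by (simp add: average_test_def indicator_def)
qed

text \<open>Never selecting has \<open>mFDR\<close> equal to 0/0 = 0. Nonemptiness is what the lower
  bounds on the infima rely on.\<close>

lemma feasible_rules_nonempty:
  assumes "0 < p0" "p0 < 1" "1 \<le> n" "0 \<le> \<alpha>"
  shows "{K \<in> decision_rules n. mFDR n \<mu> p0 K \<le> \<alpha>} \<noteq> {}"
proof -
  have K: "threshold_rule n {} \<in> decision_rules n" by (rule threshold_rule_decision_rules) simp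
  have "mFDR n \<mu> p0 (threshold_rule n {}) = 0"
    unfolding mFDR_eq[OF K assms(1-3)] average_test_threshold_rule[OF assms(3)] by simp
  with K assms(4) show ?thesis by auto
qed

section \<open>Comparison of the two criteria and the small-level bound\<close>

lemma EFN_nonneg:
  assumes K: "K \<in> decision_rules n" and p0: "0 < p0" "p0 < 1" and n: "1 \<le> n"
  shows "0 \<le> EFN n \<mu> p0 K"
  using test_integral_bounds(2)[OF average_test_test_function[OF K, of \<mu> p0], of \<mu>] p0
  unfolding EFN_eq[OF K p0 n] by simp

text \<open>\<open>mFNR\<close> divides \<open>EFN\<close> by the average probability of not
  selecting, which is at most 1. If that probability is 0, both rates are 0.\<close>

lemma EFN_le_mFNR:
  assumes K: "K \<in> decision_rules n" and p0: "0 < p0" "p0 < 1" and n: "1 \<le> n"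
  shows "EFN n \<mu> p0 K \<le> mFNR n \<mu> p0 K"
proof -
  define A where "A = (LINT y|gauss 0. average_test n \<mu> p0 K y)"
  define B where "B = (LINT y|gauss \<mu>. average_test n \<mu> p0 K y)"
  note b = test_integral_bounds[OF average_test_test_function[OF K, of \<mu> p0]]
  have A: "0 \<le> A" "A \<le> 1" and B: "0 \<le> B" "B \<le> 1" using b by (auto simp: A_def B_def)
  have nn: "0 \<le> p0 * (1 - A)" "0 \<le> (1 - p0) * (1 - B)" using A B p0 by auto
  have "p0 * (1 - A) + (1 - p0) * (1 - B) = 1 - (p0 * A + (1 - p0) * B)" by (simp add: algebra_simps)
  moreover have "0 \<le> p0 * A + (1 - p0) * B" using A B p0 by auto
  ultimately have le1: "p0 * (1 - A) + (1 - p0) * (1 - B) \<le> 1" by linarith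
  have "(1 - p0) * (1 - B) \<le> (1 - p0) * (1 - B) / (p0 * (1 - A) + (1 - p0) * (1 - B))"
  proof (cases "p0 * (1 - A) + (1 - p0) * (1 - B) = 0")
    case True
    then have z: "(1 - p0) * (1 - B) = 0" using nn by linarith
    show ?thesis unfolding z by simp
  next
    case False
    then have pos: "0 < p0 * (1 - A) + (1 - p0) * (1 - B)" using nn by linarith
    have "(1 - p0) * (1 - B) * (p0 * (1 - A) + (1 - p0) * (1 - B)) \<le> (1 - p0) * (1 - B)"
      using nn le1 by (intro mult_left_le)
    then show ?thesis using pos by (simp only: pos_le_divide_eq)
  qed
  then show ?thesis
    unfolding EFN_eq[OF K p0 n] mFNR_eq[OF K p0 n] A_def B_def .
qed

lemma mEFN_star_le_mFNR_star:
  assumes p0: "0 < p0" "p0 < 1" and n: "1 \<le> n" and \<alpha>: "0 \<le> \<alpha>"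
  shows "mEFN_star n \<mu> p0 \<alpha> \<le> mFNR_star n \<mu> p0 \<alpha>"
  unfolding mEFN_star_def mFNR_star_def
proof (rule cINF_mono)
  show "{K \<in> decision_rules n. mFDR n \<mu> p0 K \<le> \<alpha>} \<noteq> {}" by (rule feasible_rules_nonempty[OF p0 n \<alpha>])
  show "bdd_below (EFN n \<mu> p0 ` {K \<in> decision_rules n. mFDR n \<mu> p0 K \<le> \<alpha>})"
    using EFN_nonneg[OF _ p0 n] by (intro bdd_belowI[of _ 0]) auto
next
  fix K assume "K \<in> {K \<in> decision_rules n. mFDR n \<mu> p0 K \<le> \<alpha>}"
  then show "\<exists>L\<in>{K \<in> decision_rules n. mFDR n \<mu> p0 K \<le> \<alpha>}. EFN n \<mu> p0 L \<le> mFNR n \<mu> p0 K"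
    using EFN_le_mFNR[OF _ p0 n] by blast
qed

text \<open>The bound \<open>B \<le> M * \<alpha>\<^sup>2\<close> holds with one \<open>M\<close>
  for all feasible rules and all \<open>n\<close>, so the strict gap to the line survives the
  infimum.\<close>

lemma mEFN_star_small_level:
  assumes p0: "0 < p0" "p0 < 1"
  shows "\<exists>\<alpha>1. 0 < \<alpha>1 \<and> \<alpha>1 < p0 \<and>
    (\<forall>\<alpha>. \<forall>n\<ge>1. 0 < \<alpha> \<and> \<alpha> < \<alpha>1 \<longrightarrow> (1 - p0) * (1 - \<alpha> / p0) < mEFN_star n \<mu> p0 \<alpha>)"
proof -
  define M where "M = 8 * exp (3 * \<mu>\<^sup>2) * (2 * (1 - p0) / p0)\<^sup>2"
  have M: "0 < M" using p0 by (simp add: M_def)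
  \<comment> \<open>The first entry keeps \<alpha> below 1/2 and \<open>\<alpha>1\<close> below
    \<open>p0\<close>; the second yields
    \<open>M * \<alpha>\<^sup>2 < \<alpha> / p0\<close>.\<close>
  define \<alpha>1 where "\<alpha>1 = min (p0 / 2) (1 / (M * p0))"
  have "(1 - p0) * (1 - \<alpha> / p0) < mEFN_star n \<mu> p0 \<alpha>" if n: "1 \<le> n" and \<alpha>: "0 < \<alpha>" "\<alpha> < \<alpha>1" for n \<alpha>
  proof -
    have a2: "\<alpha> \<le> 1/2" using \<alpha> p0 by (simp add: \<alpha>1_def)
    have "\<alpha> < 1 / (M * p0)" using \<alpha> by (simp add: \<alpha>1_def)
    then have "M * \<alpha> < 1 / p0" using M p0 by (simp add: field_simps)
    then have "M * \<alpha> * \<alpha> < 1 / p0 * \<alpha>" using \<alpha>(1) by (rule mult_strict_right_mono)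
    then have "M * \<alpha>\<^sup>2 < \<alpha> / p0" by (simp add: power2_eq_square)
    then have "(1 - p0) * (1 - \<alpha> / p0) < (1 - p0) * (1 - M * \<alpha>\<^sup>2)"
      using p0 by (intro mult_strict_left_mono) auto
    also have "\<dots> \<le> mEFN_star n \<mu> p0 \<alpha>"
      unfolding mEFN_star_def
    proof (rule cINF_greatest)
      show "{K \<in> decision_rules n. mFDR n \<mu> p0 K \<le> \<alpha>} \<noteq> {}" using \<alpha> by (intro feasible_rules_nonempty p0 n) auto
    next
      fix K assume "K \<in> {K \<in> decision_rules n. mFDR n \<mu> p0 K \<le> \<alpha>}"
      then have K: "K \<in> decision_rules n" and le: "mFDR n \<mu> p0 K \<le> \<alpha>" by auto
      note t = average_test_test_function[OF K, of \<mu> p0]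
      have "(LINT y|gauss \<mu>. average_test n \<mu> p0 K y) \<le> M * \<alpha>\<^sup>2"
        unfolding M_def
        by (intro power_quadratic_bound t p0 \<alpha> a2 false_discovery_constraint test_integral_bounds
            le[unfolded mFDR_eq[OF K p0 n]])
      then show "(1 - p0) * (1 - M * \<alpha>\<^sup>2) \<le> EFN n \<mu> p0 K"
        unfolding EFN_eq[OF K p0 n] using p0 by (intro mult_left_mono) auto
    qed
    finally show ?thesis .
  qed
  moreover have "0 < \<alpha>1" "\<alpha>1 < p0" using p0 M by (auto simp: \<alpha>1_def)
  ultimately show ?thesis by blast
qed

subsection \<open>Levels close to the null proportion\<close>

lemma real_distribution_gauss: "real_distribution (gauss m)"
  using prob_space_gauss by (simp add: real_distribution_def real_distribution_axioms_def)

text \<open>A measure with a Lebesgue density has no atoms. Continuity later allows a prescribed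
  level to be attained exactly by a threshold.\<close>

lemma isCont_cdf_gauss: "isCont (cdf (gauss m)) z"
proof -
  interpret real_distribution "gauss m" by (rule real_distribution_gauss)
  have "AE x in lborel. x \<in> {z} \<longrightarrow> ennreal (normal_density m 1 x) = 0"
    using AE_lborel_singleton[of z] by eventually_elim auto
  then have "{z} \<in> null_sets (gauss m)"
    using null_sets_density_iff[of "\<lambda>x. ennreal (normal_density m 1 x)" lborel "{z}"] by simp
  then show ?thesis by (simp add: isCont_cdf measure_def null_setsD1)
qed

text \<open>As the density is positive, a half-line of mass 0 would be Lebesgue null, although it
  contains a unit interval.\<close>

lemma cdf_gauss_pos: "0 < cdf (gauss m) z"
proof (rule ccontr)
  interpret real_distribution "gauss m" by (rule real_distribution_gauss)
  assume "\<not> 0 < cdf (gauss m) z"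
  then have "measure (gauss m) {..z} = 0" using cdf_nonneg[of z] by (simp add: cdf_def not_less measure_le_0_iff)
  then have "emeasure (gauss m) {..z} = 0" by (simp add: emeasure_eq_measure)
  then have "{..z} \<in> null_sets (gauss m)" by (simp add: null_sets_def)
  then have "AE x in lborel. x \<in> {..z} \<longrightarrow> ennreal (normal_density m 1 x) = 0"
    by (subst (asm) null_sets_density_iff) auto
  then have "AE x in lborel. x \<notin> {..z}"
  proof eventually_elim
    case (elim x)
    then show ?case using normal_density_pos[of 1 m x] by (auto simp: ennreal_eq_0_iff)
  qed
  then have "{..z} \<in> null_sets lborel" by (subst AE_iff_null_sets) auto
  then have "{z - 1..z} \<in> null_sets lborel" by (rule null_sets_subset) auto
  then show False by (simp add: null_sets_def)
qed

lemma integral_indicator_atMost: "(LINT x|gauss m. indicator {..z} x) = cdf (gauss m) z"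
  by (simp add: cdf_def)

lemma integral_indicator_greaterThan: "(LINT x|gauss m. indicator {z<..} x) = 1 - cdf (gauss m) z"
proof -
  interpret real_distribution "gauss m" by (rule real_distribution_gauss)
  have "measure (gauss m) (space (gauss m) - {..z}) = 1 - measure (gauss m) {..z}"
    by (rule prob_compl) simp
  moreover have "space (gauss m) - {..z} = {z<..}" by auto
  ultimately show ?thesis by (simp add: cdf_def)
qed

text \<open>The likelihood ratio \<open>exp (\<mu> * x - \<mu>\<^sup>2 / 2)\<close> increases in
  \<open>x\<close> and is at most \<open>exp (\<mu> * z)\<close> on \<open>{..z}\<close>. For very
  negative \<open>z\<close>, missed signals are therefore rare compared with retained nulls.\<close>

lemma cdf_gauss_ratio:
  assumes "0 < \<mu>"
  shows "cdf (gauss \<mu>) z \<le> exp (\<mu> * z) * cdf (gauss 0) z"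
proof -
  have t: "indicator {..z} \<in> test_functions" by (auto simp: test_functions_def)
  have m: "(indicator {..z} :: real \<Rightarrow> real) \<in> borel_measurable borel" by simp
  have pt: "normal_density \<mu> 1 x * indicator {..z} x \<le> exp (\<mu> * z) * (normal_density 0 1 x * indicator {..z} x)" for x
  proof (cases "x \<le> z")
    case True
    have "- (x - \<mu>)\<^sup>2 / 2 \<le> \<mu> * x + - x\<^sup>2 / 2"
      by (simp add: power2_eq_square field_simps)
    also have "\<dots> \<le> \<mu> * z + - x\<^sup>2 / 2" using True assms by simp
    finally have "exp (- (x - \<mu>)\<^sup>2 / 2) \<le> exp (\<mu> * z) * exp (- x\<^sup>2 / 2)"
      by (simp add: exp_add[symmetric])
    then show ?thesis using True by (simp add: normal_density_def field_simps)
  qed simp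
  have "(LBINT x. normal_density \<mu> 1 x * indicator {..z} x)
      \<le> (LBINT x. exp (\<mu> * z) * (normal_density 0 1 x * indicator {..z} x))"
    by (intro integral_mono pt integrable_mult_right integrable_normal_mult t)
  then have "(LBINT x. normal_density \<mu> 1 x * indicator {..z} x)
      \<le> exp (\<mu> * z) * (LBINT x. normal_density 0 1 x * indicator {..z} x)"
    by (simp only: integral_mult_right_zero)
  then show ?thesis
    by (simp only: integral_gauss[OF m, symmetric] integral_indicator_atMost)
qed

lemma mEFN_star_large_level:
  assumes \<mu>: "0 < \<mu>" and p0: "0 < p0" "p0 < 1"
  shows "\<exists>\<alpha>2. 0 < \<alpha>2 \<and> \<alpha>2 < p0 \<and>
    (\<forall>\<alpha>. \<forall>n\<ge>1. \<alpha>2 < \<alpha> \<and> \<alpha> < p0 \<longrightarrow> mEFN_star n \<mu> p0 \<alpha> < (1 - p0) * (1 - \<alpha> / p0))"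
proof -
  define p1 where "p1 = 1 - p0"
  define P where "P = cdf (gauss 0)"
  define Q where "Q = cdf (gauss \<mu>)"
  \<comment> \<open>\<open>F z\<close> is the probability of selection when thresholding at
    \<open>z\<close>, hence the denominator of \<open>mFDR\<close>.\<close>
  define F where "F z = 1 - (p0 * P z + p1 * Q z)" for z
  \<comment> \<open>Solves \<open>exp (\<mu> * z0) = p1 / (2 * (1 + p1))\<close>; the factor 2
    provides the strictness in \<open>QP\<close>.\<close>
  define z0 where "z0 = ln (p1 / (2 * (1 + p1))) / \<mu>"
  \<comment> \<open>The second entry is the \<open>mFDR\<close> of the threshold \<open>z0\<close>;
    the first only keeps the maximum positive.\<close>
  define \<alpha>2 where "\<alpha>2 = max (p0 / 2) (p0 * (1 - P z0) / F z0)"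
  interpret X0: real_distribution "gauss 0" by (rule real_distribution_gauss)
  interpret X1: real_distribution "gauss \<mu>" by (rule real_distribution_gauss)
  have p1: "0 < p1" "p1 < 1" "p0 = 1 - p1" using p0 by (auto simp: p1_def)
  have P: "0 < P z" "P z \<le> 1" for z
    using cdf_gauss_pos X0.cdf_bounded_prob by (auto simp: P_def)
  have Q: "0 < Q z" for z
    using cdf_gauss_pos by (auto simp: Q_def)
  have QP: "(1 + p1) * Q z < p1 * P z" if "z \<le> z0" for z
  proof -
    have "\<mu> * z \<le> \<mu> * z0" using that \<mu> by simp
    also have "\<mu> * z0 = ln (p1 / (2 * (1 + p1)))" using \<mu> by (simp add: z0_def)
    finally have "exp (\<mu> * z) \<le> exp (ln (p1 / (2 * (1 + p1))))" by simp
    also have "\<dots> = p1 / (2 * (1 + p1))" using p1 by (intro exp_ln) simp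
    finally have "exp (\<mu> * z) * P z \<le> p1 / (2 * (1 + p1)) * P z"
      using P[of z] by (intro mult_right_mono) auto
    with cdf_gauss_ratio[OF \<mu>, of z] have "Q z \<le> p1 / (2 * (1 + p1)) * P z" by (simp add: P_def Q_def)
    then have "(1 + p1) * Q z \<le> (1 + p1) * (p1 / (2 * (1 + p1)) * P z)" using p1 by (intro mult_left_mono) auto
    also have "\<dots> = p1 * P z / 2" using p1 by (simp add: field_simps)
    also have "\<dots> < p1 * P z" using p1 P[of z] by simp
    finally show ?thesis .
  qed
  have F_gt: "1 - P z < F z" if "z \<le> z0" for z
  proof -
    have "p1 * Q z < p1 * P z" using QP[OF that] Q[of z] by (simp add: algebra_simps)
    then show ?thesis by (simp add: F_def p1(3) algebra_simps)
  qed
  have F: "0 < F z" if "z \<le> z0" for z using F_gt[OF that] P(2)[of z] by linarith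
  \<comment> \<open>Divided by \<open>F z\<close>, this is the claimed inequality
    \<open>Q z < 1 - \<alpha> / p0\<close> at the level \<alpha> attained by the threshold
    \<open>z\<close>.\<close>
  have miss: "Q z * F z < F z - (1 - P z)" if "z \<le> z0" for z
  proof -
    have "F z - (1 - P z) - Q z * F z = p1 * P z - (1 + p1) * Q z + Q z * (p0 * P z + p1 * Q z)"
      by (simp add: F_def p1(3) algebra_simps)
    moreover have "0 \<le> Q z * (p0 * P z + p1 * Q z)" using P[of z] Q[of z] p0 p1 by (simp add: less_imp_le)
    ultimately show ?thesis using QP[OF that] by linarith
  qed
  have "mEFN_star n \<mu> p0 \<alpha> < (1 - p0) * (1 - \<alpha> / p0)" if n: "1 \<le> n" and \<alpha>: "\<alpha>2 < \<alpha>" "\<alpha> < p0" for n \<alpha>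
  proof -
    \<comment> \<open>A zero of \<open>h\<close> is a threshold whose \<open>mFDR\<close> is exactly
      \<alpha>. The limit at minus infinity is \<open>p0 - \<alpha> > 0\<close>, while
      \<open>\<alpha> > \<alpha>2\<close> gives \<open>h z0 \<le> 0\<close>, so a zero exists below
      \<open>z0\<close>.\<close>
    define h where "h z = p0 * (1 - P z) - \<alpha> * F z" for z
    have cont: "isCont h z" for z
      unfolding h_def F_def P_def Q_def by (intro continuous_intros isCont_cdf_gauss)
    have "(h \<longlongrightarrow> p0 * (1 - 0) - \<alpha> * (1 - (p0 * 0 + p1 * 0))) at_bot"
      unfolding h_def F_def P_def Q_def by (intro tendsto_intros X0.cdf_lim_at_bot X1.cdf_lim_at_bot)
    then have "\<forall>\<^sub>F z in at_bot. 0 < h z"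
      using \<alpha> by (intro order_tendstoD) auto
    then obtain z1 where z1: "\<And>z. z \<le> z1 \<Longrightarrow> 0 < h z" by (auto simp: eventually_at_bot_linorder)
    have "p0 * (1 - P z0) / F z0 < \<alpha>" using \<alpha> by (simp add: \<alpha>2_def)
    then have "h z0 \<le> 0" using F[of z0] by (simp add: h_def field_simps)
    then obtain z where z: "z \<le> z0" "h z = 0"
      using IVT2[of h z0 0 "min z1 z0"] z1[of "min z1 z0"] cont by (auto simp: less_imp_le)
    let ?K = "threshold_rule n {z<..}"
    have K: "?K \<in> decision_rules n" by (rule threshold_rule_decision_rules) simp
    note avg = average_test_threshold_rule[OF n] integral_indicator_greaterThan
    have Feq: "p0 * (1 - P z) + (1 - p0) * (1 - Q z) = F z"
      by (simp add: F_def p1(3) algebra_simps)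
    have fdr: "mFDR n \<mu> p0 ?K = \<alpha>"
      unfolding mFDR_eq[OF K p0 n] avg P_def[symmetric] Q_def[symmetric] Feq
      using z F[OF z(1)] by (simp add: h_def field_simps)
    have "mEFN_star n \<mu> p0 \<alpha> \<le> EFN n \<mu> p0 ?K"
      unfolding mEFN_star_def
      using K fdr EFN_nonneg[OF _ p0 n] by (intro cINF_lower bdd_belowI[of _ 0]) auto
    also have "\<dots> = p1 * Q z"
      unfolding EFN_eq[OF K p0 n] avg Q_def[symmetric] by (simp add: p1_def)
    also have "\<dots> < p1 * (1 - \<alpha> / p0)"
    proof -
      have "p0 * (Q z * F z) < p0 * (F z - (1 - P z))" using miss[OF z(1)] p0 by (intro mult_strict_left_mono)
      also have "\<dots> = (p0 - \<alpha>) * F z" using z(2) by (simp add: h_def algebra_simps)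
      finally have "p0 * Q z * F z < (p0 - \<alpha>) * F z" by (simp add: mult.assoc)
      then have "p0 * Q z < p0 - \<alpha>" using F[OF z(1)] by simp
      then have "Q z < 1 - \<alpha> / p0" using p0 by (simp add: field_simps)
      then show ?thesis using p1 by simp
    qed
    finally show ?thesis by (simp add: p1_def)
  qed
  moreover have "0 < \<alpha>2" using p0 by (simp add: \<alpha>2_def less_max_iff_disj)
  moreover have "\<alpha>2 < p0"
  proof -
    have "p0 * (1 - P z0) < p0 * F z0" using F_gt[of z0] p0 by simp
    then have "p0 * (1 - P z0) / F z0 < p0" using F[of z0] by (simp add: pos_divide_less_eq)
    then show ?thesis using p0 by (simp add: \<alpha>2_def)
  qed
  ultimately show ?thesis by blast
qed

subsection \<open>Weak signals\<close>

text \<open>Both chi-square bounds make \<open>(B - A)\<^sup>2\<close> small relative to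
  \<open>A\<close> and to \<open>1 - B\<close>, and the two factors cannot both be small because
  \<open>A\<close> and \<open>B\<close> differ by at most 1/4. Excluding \<open>B = 0\<close> and
  \<open>A = 1\<close> removes the corners where both sides vanish.\<close>

lemma weak_signal_inequality:
  fixes A B C p0 :: real
  assumes "0 \<le> A" "B \<le> 1" "A \<le> B" "C \<le> 1/16"
    and chi: "(B - A)\<^sup>2 \<le> C * A" "(B - A)\<^sup>2 \<le> C * (1 - B)"
    and nz: "B \<noteq> 0" "A \<noteq> 1" and p0: "0 < p0" "p0 < 1"
  shows "p0 * (1 - p0) * (B - A)\<^sup>2 < A * (1 - B)"
proof -
  have chiA: "(B - A)\<^sup>2 \<le> A / 16"
    using chi(1) mult_right_mono[OF assms(4,1)] by simp
  have chiB: "(B - A)\<^sup>2 \<le> (1 - B) / 16"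
    using chi(2) mult_right_mono[OF assms(4), of "1 - B"] assms(2) by simp
  have A: "0 < A" using chiA assms(1) nz(1) by (cases "A = 0") auto
  have B: "B < 1" using chiB assms(2) nz(2) by (cases "B = 1") auto
  have "(B - A)\<^sup>2 \<le> (1/4)\<^sup>2" using chiA assms(2,3) by (simp add: power2_eq_square)
  then have D: "B - A \<le> 1/4" by (rule power2_le_imp_le) simp
  have "p0 * (1 - p0) \<le> 1/4" using zero_le_power2[of "p0 - 1/2"] by (simp add: power2_eq_square algebra_simps)
  then have "p0 * (1 - p0) * (B - A)\<^sup>2 \<le> 1/4 * (B - A)\<^sup>2" by (intro mult_right_mono) auto
  also have "\<dots> < A * (1 - B)"
  \<comment> \<open>Either \<open>A \<le> 1/2\<close>, and then \<open>1 - B \<ge> 1/4\<close>, or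
    \<open>A\<close> itself exceeds 1/2; the bound for the other factor finishes each case.\<close>
  proof (cases "A \<le> 1/2")
    case True
    have "A * (1/4) \<le> A * (1 - B)" using A True D by (intro mult_left_mono) auto
    then show ?thesis using chiA A by linarith
  next
    case False
    have "1/2 * (1 - B) \<le> A * (1 - B)" using B False by (intro mult_right_mono) auto
    moreover have "1/4 * (B - A)\<^sup>2 \<le> (1 - B) / 64" using chiB by simp
    moreover have "(1 - B) / 64 < 1/2 * (1 - B)" using B by simp
    ultimately show ?thesis by (meson le_less_trans less_le_trans)
  qed
  finally show ?thesis .
qed

text \<open>With selection probability \<open>F\<close>, the constraint reads
  \<open>(p0 - \<alpha>) * F \<le> p0 * (1 - p0) * (B - A)\<close>. Comparing the line with
  \<open>mFNR\<close> then reduces to the weak-signal inequality. The first conclusion supplies the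
  nonzero denominator for continuity.\<close>

lemma weak_signal_mFNR_gap:
  fixes A B C p0 \<alpha> :: real
  assumes "0 \<le> A" "B \<le> 1" "C \<le> 1/16"
    and chi: "(B - A)\<^sup>2 \<le> C * A" "(B - A)\<^sup>2 \<le> C * (1 - B)"
    and p0: "0 < p0" "p0 < 1" and \<alpha>: "0 < \<alpha>" "\<alpha> < p0"
    and fdr: "p0 * A * (1 - \<alpha>) \<le> \<alpha> * (1 - p0) * B"
  shows "0 < p0 * (1 - A) + (1 - p0) * (1 - B)"
    and "(1 - p0) * (1 - \<alpha> / p0) < (1 - p0) * (1 - B) / (p0 * (1 - A) + (1 - p0) * (1 - B))"
proof -
  define F where "F = p0 * A + (1 - p0) * B"
  \<comment> \<open>This form of \<open>\<alpha> < p0\<close> turns the constraint into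
    \<open>A \<le> B\<close> and rules out \<open>A = B = 1\<close>.\<close>
  have lt: "\<alpha> * (1 - p0) < p0 * (1 - \<alpha>)" using \<alpha> by (simp add: algebra_simps)
  have "0 \<le> p0 * A * (1 - \<alpha>)" using assms by simp
  then have "0 \<le> \<alpha> * (1 - p0) * B" using fdr by linarith
  moreover have c: "0 < \<alpha> * (1 - p0)" using \<alpha> p0 by simp
  ultimately have B0: "0 \<le> B"
    using mult_le_cancel_left_pos[OF c, of 0 B] by (simp only: mult_zero_right)
  have "\<alpha> * (1 - p0) * B \<le> p0 * (1 - \<alpha>) * B" using lt B0 by (intro mult_right_mono) auto
  then have "p0 * (1 - \<alpha>) * A \<le> p0 * (1 - \<alpha>) * B" using fdr by (simp add: mult_ac)
  then have AB: "A \<le> B" using p0 \<alpha> by simp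
  have A1: "A \<noteq> 1"
  proof
    assume "A = 1"
    then have "B = 1" using AB assms(2) by simp
    then show False using fdr lt \<open>A = 1\<close> by simp
  qed
  have 1: "p0 * (1 - A) + (1 - p0) * (1 - B) = 1 - F" by (simp add: F_def algebra_simps)
  have "0 < p0 * (1 - A)" using A1 AB assms(2) p0 by simp
  moreover have "0 \<le> (1 - p0) * (1 - B)" using assms(2) p0 by simp
  ultimately show pos: "0 < p0 * (1 - A) + (1 - p0) * (1 - B)" by linarith
  have "p0 - \<alpha> < p0 * ((1 - B) / (1 - F))"
  \<comment> \<open>For \<open>B = 0\<close> also \<open>F = 0\<close>, and \<open>F\<close> cannot
    be cancelled; the claim is then just \<open>p0 - \<alpha> < p0\<close>.\<close>
  proof (cases "B = 0")
    case True
    then have "A = 0" using AB assms(1) by simp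
    then show ?thesis using True \<alpha> by (simp add: F_def)
  next
    case False
    have "0 < (1 - p0) * B" using False B0 p0 by simp
    moreover have "0 \<le> p0 * A" using assms(1) p0 by simp
    ultimately have F: "0 < F" by (simp add: F_def)
    have key: "(1 - p0) * (B - A) * (1 - F) < (1 - B) * F"
    proof -
      have "(1 - B) * F - (1 - p0) * (B - A) * (1 - F) = A * (1 - B) - p0 * (1 - p0) * (B - A)\<^sup>2"
        by (simp add: F_def power2_eq_square algebra_simps)
      then show ?thesis
        using weak_signal_inequality[OF assms(1,2) AB assms(3) chi False A1 p0] by linarith
    qed
    have "(p0 - \<alpha>) * F \<le> p0 * ((1 - p0) * (B - A))" using fdr by (simp add: F_def algebra_simps)
    then have "(p0 - \<alpha>) * F * (1 - F) \<le> p0 * ((1 - p0) * (B - A)) * (1 - F)"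
      using pos by (intro mult_right_mono) (auto simp: 1)
    also have "\<dots> = p0 * ((1 - p0) * (B - A) * (1 - F))" by (simp only: mult_ac)
    also have "\<dots> < p0 * ((1 - B) * F)" using key p0 by (intro mult_strict_left_mono)
    finally have "(p0 - \<alpha>) * (1 - F) * F < p0 * (1 - B) * F" by (simp only: mult_ac)
    then have "(p0 - \<alpha>) * (1 - F) < p0 * (1 - B)" using F by simp
    then show ?thesis using pos by (simp add: 1 pos_less_divide_eq)
  qed
  then have "(1 - \<alpha> / p0) < (1 - B) / (1 - F)" using p0 by (simp add: field_simps)
  then have "(1 - p0) * (1 - \<alpha> / p0) < (1 - p0) * ((1 - B) / (1 - F))"
    using p0 by (intro mult_strict_left_mono) auto
  then show "(1 - p0) * (1 - \<alpha> / p0) < (1 - p0) * (1 - B) / (p0 * (1 - A) + (1 - p0) * (1 - B))"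
    by (simp add: 1)
qed

lemma mFNR_star_weak_signal:
  assumes C: "exp (\<mu>\<^sup>2) - 1 \<le> 1/16" and p0: "0 < p0" "p0 < 1" and \<alpha>: "0 < \<alpha>" "\<alpha> < p0" and n: "1 \<le> n"
  shows "(1 - p0) * (1 - \<alpha> / p0) < mFNR_star n \<mu> p0 \<alpha>"
proof -
  define C where "C = exp (\<mu>\<^sup>2) - 1"
  define \<phi> where "\<phi> w = (1 - p0) * (1 - snd w) / (p0 * (1 - fst w) + (1 - p0) * (1 - snd w))" for w :: "real \<times> real"
  \<comment> \<open>A compact set containing the pair (size, power) of every feasible rule.
    Strictness for each rule alone would be lost in the infimum; a minimum of \<phi> over
    \<open>S\<close> preserves it.\<close>
  define S where "S = ({0..1} \<times> {0..1}) \<inter> {w. (snd w - fst w)\<^sup>2 \<le> C * fst w} \<inter>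
    {w. (snd w - fst w)\<^sup>2 \<le> C * (1 - snd w)} \<inter> {w. p0 * fst w * (1 - \<alpha>) \<le> \<alpha> * (1 - p0) * snd w}"
  have mem: "w \<in> S \<Longrightarrow> 0 \<le> fst w \<and> snd w \<le> 1 \<and> (snd w - fst w)\<^sup>2 \<le> C * fst w \<and> (snd w - fst w)\<^sup>2 \<le> C * (1 - snd w)
    \<and> p0 * fst w * (1 - \<alpha>) \<le> \<alpha> * (1 - p0) * snd w" for w
    by (auto simp: S_def)
  have C16: "C \<le> 1/16" using assms(1) by (simp add: C_def)
  have "compact S"
    unfolding S_def
    by (intro compact_Int_closed compact_Times compact_Icc closed_Collect_le continuous_intros)
  moreover have "(0, 0) \<in> S" by (simp add: S_def C_def)
  moreover have "continuous_on S \<phi>"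
    unfolding \<phi>_def
  proof (intro continuous_intros ballI)
    show "p0 * (1 - fst w) + (1 - p0) * (1 - snd w) \<noteq> 0" if "w \<in> S" for w
      using weak_signal_mFNR_gap(1)[OF _ _ C16 _ _ p0 \<alpha>, of "fst w" "snd w"] mem[OF that] by simp
  qed
  ultimately obtain w where w: "w \<in> S" "\<And>v. v \<in> S \<Longrightarrow> \<phi> w \<le> \<phi> v"
    using continuous_attains_inf[of S \<phi>] by blast
  have "(1 - p0) * (1 - \<alpha> / p0) < \<phi> w"
    unfolding \<phi>_def using mem[OF w(1)] by (intro weak_signal_mFNR_gap(2)[OF _ _ C16 _ _ p0 \<alpha>]) auto
  also have "\<phi> w \<le> mFNR_star n \<mu> p0 \<alpha>"
    unfolding mFNR_star_def
  proof (rule cINF_greatest)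
    show "{K \<in> decision_rules n. mFDR n \<mu> p0 K \<le> \<alpha>} \<noteq> {}" using \<alpha> by (intro feasible_rules_nonempty p0 n) auto
  next
    fix K assume "K \<in> {K \<in> decision_rules n. mFDR n \<mu> p0 K \<le> \<alpha>}"
    then have K: "K \<in> decision_rules n" and le: "mFDR n \<mu> p0 K \<le> \<alpha>" by auto
    note t = average_test_test_function[OF K, of \<mu> p0]
    let ?A = "LINT y|gauss 0. average_test n \<mu> p0 K y" and ?B = "LINT y|gauss \<mu>. average_test n \<mu> p0 K y"
    have "(?A, ?B) \<in> S"
      using test_integral_bounds[OF t] test_chi_square[OF t, of \<mu> 0] test_chi_square_complement[OF t, of \<mu> 0]
        false_discovery_constraint[OF test_integral_bounds(1)[OF t] test_integral_bounds(1)[OF t] p0 le[unfolded mFDR_eq[OF K p0 n]]]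
      by (simp add: S_def C_def)
    from w(2)[OF this] show "\<phi> w \<le> mFNR n \<mu> p0 K"
      unfolding mFNR_eq[OF K p0 n] by (simp add: \<phi>_def)
  qed
  finally show ?thesis .
qed

section \<open>The four claims assembled\<close>

theorem proposition25:
  shows
    "(\<exists>\<mu>0::real. 0 < \<mu>0 \<and>
         (\<forall>\<mu> \<pi>0 \<alpha>. \<forall>n\<ge>1. 0 < \<mu> \<and> \<mu> < \<mu>0 \<and> 0 < \<pi>0 \<and> \<pi>0 < 1 \<and> 0 < \<alpha> \<and> \<alpha> < \<pi>0 \<longrightarrow>
            mFNR_star n \<mu> \<pi>0 \<alpha> > (1 - \<pi>0) * (1 - \<alpha> / \<pi>0))) \<and>
     (\<forall>\<mu> \<pi>0. 0 < \<mu> \<and> 0 < \<pi>0 \<and> \<pi>0 < 1 \<longrightarrow>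
         (\<exists>\<alpha>0. 0 < \<alpha>0 \<and> \<alpha>0 < \<pi>0 \<and>
           (\<forall>\<alpha>. \<forall>n\<ge>1. 0 < \<alpha> \<and> \<alpha> < \<alpha>0 \<longrightarrow>
              mFNR_star n \<mu> \<pi>0 \<alpha> > (1 - \<pi>0) * (1 - \<alpha> / \<pi>0)))) \<and>
     (\<forall>\<mu> \<pi>0. 0 < \<mu> \<and> 0 < \<pi>0 \<and> \<pi>0 < 1 \<longrightarrow>
         (\<exists>\<alpha>1. 0 < \<alpha>1 \<and> \<alpha>1 < \<pi>0 \<and>
           (\<forall>\<alpha>. \<forall>n\<ge>1. 0 < \<alpha> \<and> \<alpha> < \<alpha>1 \<longrightarrow>
              mEFN_star n \<mu> \<pi>0 \<alpha> > (1 - \<pi>0) * (1 - \<alpha> / \<pi>0)))) \<and>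
     (\<forall>\<mu> \<pi>0. 0 < \<mu> \<and> 0 < \<pi>0 \<and> \<pi>0 < 1 \<longrightarrow>
         (\<exists>\<alpha>2. 0 < \<alpha>2 \<and> \<alpha>2 < \<pi>0 \<and>
           (\<forall>\<alpha>. \<forall>n\<ge>1. \<alpha>2 < \<alpha> \<and> \<alpha> < \<pi>0 \<longrightarrow>
              mEFN_star n \<mu> \<pi>0 \<alpha> < (1 - \<pi>0) * (1 - \<alpha> / \<pi>0))))"
proof (intro conjI)
  show "\<exists>\<mu>0::real. 0 < \<mu>0 \<and>
         (\<forall>\<mu> \<pi>0 \<alpha>. \<forall>n\<ge>1. 0 < \<mu> \<and> \<mu> < \<mu>0 \<and> 0 < \<pi>0 \<and> \<pi>0 < 1 \<and> 0 < \<alpha> \<and> \<alpha> < \<pi>0 \<longrightarrow>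
            mFNR_star n \<mu> \<pi>0 \<alpha> > (1 - \<pi>0) * (1 - \<alpha> / \<pi>0))"
  \<comment> \<open>For \<mu> below 1/5, \<open>exp (\<mu>\<^sup>2) - 1\<close> is at most 1/25 +
    1/625, which is below the required 1/16 whatever \<open>\<pi>0\<close> is.\<close>
  proof (intro exI[of _ "1/5"] conjI allI impI)
    fix \<mu> \<pi>0 \<alpha> :: real and n :: nat
    assume n: "1 \<le> n" and *: "0 < \<mu> \<and> \<mu> < 1/5 \<and> 0 < \<pi>0 \<and> \<pi>0 < 1 \<and> 0 < \<alpha> \<and> \<alpha> < \<pi>0"
    have "\<mu>\<^sup>2 \<le> (1/5)\<^sup>2" using * by (intro power_mono) auto
    then have sq: "\<mu>\<^sup>2 \<le> 1/25" by (simp add: power2_eq_square)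
    have "exp (\<mu>\<^sup>2) \<le> 1 + \<mu>\<^sup>2 + (\<mu>\<^sup>2)\<^sup>2" using sq by (intro exp_bound) auto
    also have "\<dots> \<le> 1 + 1/25 + (1/25)\<^sup>2" using sq by (intro add_mono power_mono) auto
    finally have "exp (\<mu>\<^sup>2) - 1 \<le> 1/16" by (simp add: power2_eq_square)
    then show "mFNR_star n \<mu> \<pi>0 \<alpha> > (1 - \<pi>0) * (1 - \<alpha> / \<pi>0)"
      using * n by (intro mFNR_star_weak_signal) auto
  qed simp
next
  show "\<forall>\<mu> \<pi>0. 0 < \<mu> \<and> 0 < \<pi>0 \<and> \<pi>0 < 1 \<longrightarrow>
         (\<exists>\<alpha>0. 0 < \<alpha>0 \<and> \<alpha>0 < \<pi>0 \<and>
           (\<forall>\<alpha>. \<forall>n\<ge>1. 0 < \<alpha> \<and> \<alpha> < \<alpha>0 \<longrightarrow>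
              mFNR_star n \<mu> \<pi>0 \<alpha> > (1 - \<pi>0) * (1 - \<alpha> / \<pi>0)))"
  proof (intro allI impI)
    fix \<mu> \<pi>0 :: real
    assume *: "0 < \<mu> \<and> 0 < \<pi>0 \<and> \<pi>0 < 1"
    then obtain \<alpha>0 where "0 < \<alpha>0" "\<alpha>0 < \<pi>0" and small:
      "\<And>\<alpha> n. 1 \<le> n \<Longrightarrow> 0 < \<alpha> \<Longrightarrow> \<alpha> < \<alpha>0 \<Longrightarrow> (1 - \<pi>0) * (1 - \<alpha> / \<pi>0) < mEFN_star n \<mu> \<pi>0 \<alpha>"
      using mEFN_star_small_level[of \<pi>0 \<mu>] by blast
    moreover have "(1 - \<pi>0) * (1 - \<alpha> / \<pi>0) < mFNR_star n \<mu> \<pi>0 \<alpha>"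
      if "1 \<le> n" "0 < \<alpha>" "\<alpha> < \<alpha>0" for n \<alpha>
      using small[OF that] mEFN_star_le_mFNR_star[of \<pi>0 n \<alpha> \<mu>] that * by simp
    ultimately show "\<exists>\<alpha>0. 0 < \<alpha>0 \<and> \<alpha>0 < \<pi>0 \<and>
           (\<forall>\<alpha>. \<forall>n\<ge>1. 0 < \<alpha> \<and> \<alpha> < \<alpha>0 \<longrightarrow>
              mFNR_star n \<mu> \<pi>0 \<alpha> > (1 - \<pi>0) * (1 - \<alpha> / \<pi>0))"
      by blast
  qed
next
  show "\<forall>\<mu> \<pi>0. 0 < \<mu> \<and> 0 < \<pi>0 \<and> \<pi>0 < 1 \<longrightarrow>
         (\<exists>\<alpha>1. 0 < \<alpha>1 \<and> \<alpha>1 < \<pi>0 \<and>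
           (\<forall>\<alpha>. \<forall>n\<ge>1. 0 < \<alpha> \<and> \<alpha> < \<alpha>1 \<longrightarrow>
              mEFN_star n \<mu> \<pi>0 \<alpha> > (1 - \<pi>0) * (1 - \<alpha> / \<pi>0)))"
    using mEFN_star_small_level by blast
next
  show "\<forall>\<mu> \<pi>0. 0 < \<mu> \<and> 0 < \<pi>0 \<and> \<pi>0 < 1 \<longrightarrow>
         (\<exists>\<alpha>2. 0 < \<alpha>2 \<and> \<alpha>2 < \<pi>0 \<and>
           (\<forall>\<alpha>. \<forall>n\<ge>1. \<alpha>2 < \<alpha> \<and> \<alpha> < \<pi>0 \<longrightarrow>
              mEFN_star n \<mu> \<pi>0 \<alpha> < (1 - \<pi>0) * (1 - \<alpha> / \<pi>0)))"
    using mEFN_star_large_level by blast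
qed

end
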